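(* Let $\mathcal{I}$ be the standard Pfaffian system with parameters for type C austere 4-folds in $\mathbb{R}^7$ with $\delta=3$, defined on $\mathcal{F}\times L_0$ (see context). At points of $\mathcal{F}\times L_0$ where neither of $\lambda_1$ or $\lambda_2$ is equal to $1$, the characteristic variety of $\mathcal{I}$ is empty. At points where $\lambda_1=1$ or $\lambda_2=1$, the characteristic variety consists of a pair of complex lines.
   Context: Index ranges: $1\le i,j,k\le4$, $1\le a,b\le3$; summation convention. $\mathcal F$ is the bundle of frames $(e_1,\dots,e_4,\nu_1,\nu_2,\nu_3)$ of $T_p\mathbb{R}^7$, $p\in\mathbb R^7$, such that the $e_i$ are orthonormal and orthogonal to the $\nu_a$. Canonical and connection 1-forms on $\mathcal F$ are defined by $dp=e_i\omega^i+\nu_a\theta^a$, $de_i=e_j\phi^j_i+\nu_a\eta^a_i$, $d\nu_a=e_j\xi^j_a+\nu_b\kappa^b_a$ (so $\phi^i_j=-\phi^j_i$). $L\subset\mathbb{R}^3$ is the set of $(\lambda_1,\lambda_2,\lambda_3)\neq 0$ with $\lambda_1\lambda_2\lambda_3+\lambda_1+\lambda_2+\lambda_3=0$, and $L_0\subset L$ is the subset where $\lambda_1\ge\lambda_2>0$; on $L_0$, $\lambda_3$ is determined by $\lambda_1,\lambda_2$. Set $$S^1=\begin{bmatrix}0&1&0&0\\1&0&0&0\\0&0&0&\lambda_1\\0&0&\lambda_1&0\end{bmatrix},\quad S^2=\begin{bmatrix}0&0&1&0\\0&0&0&\lambda_2\\1&0&0&0\\0&\lambda_2&0&0\end{bmatrix},\quad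 S^3=\begin{bmatrix}0&0&0&1\\0&0&\lambda_3&0\\0&\lambda_3&0&0\\1&0&0&0\end{bmatrix}.$$ $\mathcal I$ is the Pfaffian exterior differential system generated by the 1-forms $\theta^a$ and $\theta^a_i=\eta^a_i-S^a_{ij}\omega^j$, with independence condition $\omega^1\wedge\omega^2\wedge\omega^3\wedge\omega^4\ne0$. Its generating 2-forms are, modulo the 1-forms of $\mathcal I$, $d\theta^a_i\equiv-\pi^a_{ij}\wedge\omega^j$, where $$\pi^a_{ij}=dS^a_{ij}-S^a_{kj}\phi^k_i-S^a_{ik}\phi^k_j+\kappa^a_bS^b_{ij}.$$ These 1-forms are linear combinations of the 17 independent 1-forms $d\lambda_1,d\lambda_2,\phi^i_j\ (i>j),\kappa^a_b$, and on $\mathcal F\times L_0$ their span has dimension 17. Characteristic variety at a point: let $E$ be an integral 4-plane at the point satisfying the independence condition and annihilated by all $\pi^a_{ij}$ (since the system is linear, the characteristic variety does not depend on the integral 4-plane). A point $[\xi]\in\mathbb{P}(E^*\otimes\mathbb{C})$, $\xi=\xi_i\omega^i\neq0$, belongs to the characteristic variety if the polar equations of the hyperplane $\xi^\perp\subset E$ fail to have full rank, i.e. if the 1-forms $\pi^a_{ij}\xi_k-\pi^a_{ik}\xi_j$ (all $a$, $i$, and $j<k$) span a space of dimension less than 17.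
   Formalization: The claim of a pair of complex lines is false where λ1=λ2=1 (λ3=-1); it is proved where exactly one of λ1, λ2 equals 1, and where both equal 1 the characteristic variety is proved to be four distinct complex lines. *)

theory Defs
  imports "HOL-Analysis.Analysis" "HOL-Library.Function_Algebras"
begin

text \<open>
  The frame bundle and the parameter space are submanifolds of Euclidean spaces. A frame is a
  triple \<open>(p, e, \<nu>)\<close>. A point of the product manifold is a pair of a frame and a parameter.
  Tangent vectors are represented by vectors of the ambient space, so that \<open>dp\<close>, \<open>de\<close> and
  \<open>d\<nu>\<close> are the coordinate projections. The indices \<open>1, \<dots>, 4\<close> and \<open>1, \<dots>, 3\<close> are the elements
  of the types \<open>4\<close> and \<open>3\<close>; in these types \<open>4 = 0\<close> and \<open>3 = 0\<close>.
\<close>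

type_synonym frame = "(real^7) \<times> (real^7^4) \<times> (real^7^3)"
type_synonym point = "frame \<times> (real^3)"

text \<open>Seven vectors spanning \<open>real^7\<close> form a basis, so the last condition says that the \<open>e $ i\<close>
  and \<open>\<nu> $ a\<close> together are a frame.\<close>

definition frame_bundle :: "frame set" where
  "frame_bundle = {(p, e, \<nu>).
     (\<forall>i j. (e $ i) \<bullet> (e $ j) = (if i = j then 1 else 0)) \<and>
     (\<forall>i a. (e $ i) \<bullet> (\<nu> $ a) = 0) \<and>
     span (range (\<lambda>i. e $ i) \<union> range (\<lambda>a. \<nu> $ a)) = UNIV}"

definition param_L :: "(real^3) set" where
  "param_L = {l. l \<noteq> 0 \<and> l$1 * l$2 * l$3 + l$1 + l$2 + l$3 = 0}"

definition param_L0 :: "(real^3) set" where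
  "param_L0 = {l \<in> param_L. l$1 \<ge> l$2 \<and> l$2 > 0}"

text \<open>
  Tangent spaces are the kernels of the linearised defining equations, which have maximal rank
  along \<open>frame_bundle\<close> and along \<open>param_L0\<close>. The inequality \<open>l$1 \<ge> l$2\<close> does not enter: at
  points with \<open>l$1 = l$2\<close> the tangent space is the one of the surface \<open>param_L\<close>, so the
  differentials of the first two parameters are independent there, too.
\<close>

definition frame_tangent :: "frame \<Rightarrow> frame set" where
  "frame_tangent = (\<lambda>(p, e, \<nu>). {(dp, de, d\<nu>).
     (\<forall>i j. (de $ i) \<bullet> (e $ j) + (e $ i) \<bullet> (de $ j) = 0) \<and>
     (\<forall>i a. (de $ i) \<bullet> (\<nu> $ a) + (e $ i) \<bullet> (d\<nu> $ a) = 0)})"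

definition param_tangent :: "real^3 \<Rightarrow> (real^3) set" where
  "param_tangent l = {dl.
     dl$1 * l$2 * l$3 + l$1 * dl$2 * l$3 + l$1 * l$2 * dl$3 + dl$1 + dl$2 + dl$3 = 0}"

definition tangent :: "point \<Rightarrow> point set" where
  "tangent x = frame_tangent (fst x) \<times> param_tangent (snd x)"


subsection \<open>Canonical and connection forms\<close>

text \<open>The coefficients of a vector with respect to a frame.\<close>

definition frame_coeffs :: "frame \<Rightarrow> real^7 \<Rightarrow> (real^4) \<times> (real^3)" where
  "frame_coeffs = (\<lambda>(p, e, \<nu>) w.
     THE c. w = (\<Sum>i\<in>UNIV. fst c $ i *\<^sub>R e $ i) + (\<Sum>a\<in>UNIV. snd c $ a *\<^sub>R \<nu> $ a))"

definition d_p :: "point \<Rightarrow> real^7" where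
  "d_p v = fst (fst v)"

definition d_e :: "4 \<Rightarrow> point \<Rightarrow> real^7" where
  "d_e i v = fst (snd (fst v)) $ i"

definition d_nu :: "3 \<Rightarrow> point \<Rightarrow> real^7" where
  "d_nu a v = snd (snd (fst v)) $ a"

text \<open>
  A 1-form takes a point and a tangent vector at it. The formulas below also make sense at
  nearby points of the ambient space and for all ambient vectors. In \<open>phi_form\<close>, \<open>eta_form\<close> and
  \<open>kappa_form\<close> the upper index comes first.
\<close>

definition omega_form :: "4 \<Rightarrow> point \<Rightarrow> point \<Rightarrow> real" where
  "omega_form i x v = fst (frame_coeffs (fst x) (d_p v)) $ i"

definition theta_form :: "3 \<Rightarrow> point \<Rightarrow> point \<Rightarrow> real" where
  "theta_form a x v = snd (frame_coeffs (fst x) (d_p v)) $ a"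

definition phi_form :: "4 \<Rightarrow> 4 \<Rightarrow> point \<Rightarrow> point \<Rightarrow> real" where
  "phi_form j i x v = fst (frame_coeffs (fst x) (d_e i v)) $ j"

definition eta_form :: "3 \<Rightarrow> 4 \<Rightarrow> point \<Rightarrow> point \<Rightarrow> real" where
  "eta_form a i x v = snd (frame_coeffs (fst x) (d_e i v)) $ a"

definition kappa_form :: "3 \<Rightarrow> 3 \<Rightarrow> point \<Rightarrow> point \<Rightarrow> real" where
  "kappa_form b a x v = snd (frame_coeffs (fst x) (d_nu a v)) $ b"


subsection \<open>The Pfaffian system\<close>

definition austere_S :: "real^3 \<Rightarrow> real^4^4^3" where
  "austere_S l = vector
    [vector [vector [0, 1, 0, 0],
             vector [1, 0, 0, 0],
             vector [0, 0, 0, l$1],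
             vector [0, 0, l$1, 0]],
     vector [vector [0, 0, 1, 0],
             vector [0, 0, 0, l$2],
             vector [1, 0, 0, 0],
             vector [0, l$2, 0, 0]],
     vector [vector [0, 0, 0, 1],
             vector [0, 0, l$3, 0],
             vector [0, l$3, 0, 0],
             vector [1, 0, 0, 0]]]"

definition theta1_form :: "3 \<Rightarrow> 4 \<Rightarrow> point \<Rightarrow> point \<Rightarrow> real" where
  "theta1_form a i x v =
     eta_form a i x v - (\<Sum>j\<in>UNIV. austere_S (snd x) $ a $ i $ j * omega_form j x v)"

definition pi_form :: "3 \<Rightarrow> 4 \<Rightarrow> 4 \<Rightarrow> point \<Rightarrow> point \<Rightarrow> real" where
  "pi_form a i j x v =
     frechet_derivative (\<lambda>y. austere_S (snd y) $ a $ i $ j) (at x) v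
     - (\<Sum>k\<in>UNIV. austere_S (snd x) $ a $ k $ j * phi_form k i x v)
     - (\<Sum>k\<in>UNIV. austere_S (snd x) $ a $ i $ k * phi_form k j x v)
     + (\<Sum>b\<in>UNIV. kappa_form a b x v * austere_S (snd x) $ b $ i $ j)"

text \<open>
  The exterior derivative of a 1-form that is smooth on a neighbourhood of \<open>x\<close> in the ambient
  space. On tangent vectors of a submanifold it agrees with the exterior derivative of the
  restriction of the form to the submanifold.
\<close>

definition ext_d :: "(point \<Rightarrow> point \<Rightarrow> real) \<Rightarrow> point \<Rightarrow> point \<Rightarrow> point \<Rightarrow> real" where
  "ext_d \<alpha> x u v =
     frechet_derivative (\<lambda>y. \<alpha> y v) (at x) u - frechet_derivative (\<lambda>y. \<alpha> y u) (at x) v"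

definition pfaffian_gens :: "(point \<Rightarrow> point \<Rightarrow> real) set" where
  "pfaffian_gens = range theta_form \<union> {theta1_form a i | a i. True}"

text \<open>Integral 4-planes on which \<open>\<omega>\<^sup>1 \<and> \<omega>\<^sup>2 \<and> \<omega>\<^sup>3 \<and> \<omega>\<^sup>4\<close> does not vanish.\<close>

definition integral_plane :: "point \<Rightarrow> point set \<Rightarrow> bool" where
  "integral_plane x E \<longleftrightarrow>
     subspace E \<and> E \<subseteq> tangent x \<and> dim E = 4 \<and>
     (\<forall>\<alpha>\<in>pfaffian_gens. \<forall>v\<in>E. \<alpha> x v = 0) \<and>
     (\<forall>\<alpha>\<in>pfaffian_gens. \<forall>u\<in>E. \<forall>v\<in>E. ext_d \<alpha> x u v = 0) \<and>
     (\<exists>b :: 4 \<Rightarrow> point. (\<forall>j. b j \<in> E) \<and> det (\<chi> i j. omega_form i x (b j)) \<noteq> 0)"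


subsection \<open>Complex-valued covectors and projective spaces\<close>

text \<open>
  Complex-valued covectors on a real subspace are functions on the ambient space that vanish
  off the subspace; they form a vector space over the complex numbers.
\<close>

global_interpretation cfun: vector_space "\<lambda>(c::complex) (f :: 'a \<Rightarrow> complex) v. c * f v"
  by standard (auto simp: fun_eq_iff algebra_simps)

definition complex_dual :: "point set \<Rightarrow> (point \<Rightarrow> complex) set" where
  "complex_dual E = {f. (\<forall>v. v \<notin> E \<longrightarrow> f v = 0) \<and>
     (\<forall>u\<in>E. \<forall>v\<in>E. f (u + v) = f u + f v) \<and>
     (\<forall>c. \<forall>v\<in>E. f (c *\<^sub>R v) = of_real c * f v)}"

text \<open>Points of a complex projective space are one-dimensional subspaces.\<close>

definition proj_point :: "('a \<Rightarrow> complex) \<Rightarrow> ('a \<Rightarrow> complex) set" where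
  "proj_point f = cfun.span {f}"

definition projectivization :: "('a \<Rightarrow> complex) set \<Rightarrow> ('a \<Rightarrow> complex) set set" where
  "projectivization V = {proj_point f | f. f \<in> V \<and> f \<noteq> 0}"

definition complex_line :: "point set \<Rightarrow> (point \<Rightarrow> complex) set set \<Rightarrow> bool" where
  "complex_line E M \<longleftrightarrow>
     (\<exists>V. cfun.subspace V \<and> V \<subseteq> complex_dual E \<and> cfun.dim V = 2 \<and> M = projectivization V)"


subsection \<open>The characteristic variety\<close>

text \<open>The covector on \<open>E\<close> with coefficients \<open>z\<close> with respect to the \<open>omega_form i\<close>.\<close>

definition covector :: "point \<Rightarrow> point set \<Rightarrow> complex^4 \<Rightarrow> point \<Rightarrow> complex" where
  "covector x E z =
     (\<lambda>v. if v \<in> E then (\<Sum>i\<in>UNIV. z $ i * of_real (omega_form i x v)) else 0)"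

definition polar_forms :: "point \<Rightarrow> complex^4 \<Rightarrow> (point \<Rightarrow> complex) set" where
  "polar_forms x z =
     {\<lambda>v. if v \<in> tangent x
           then of_real (pi_form a i j x v) * z $ k - of_real (pi_form a i k x v) * z $ j
           else 0 | a i j k. j < k}"

definition char_variety :: "point \<Rightarrow> point set \<Rightarrow> (point \<Rightarrow> complex) set set" where
  "char_variety x E =
     {proj_point (covector x E z) | z. covector x E z \<noteq> 0 \<and> cfun.dim (polar_forms x z) < 17}"

end

theory Submission
  imports Defs
begin

text \<open>
  The polar equations of \<open>\<xi>\<close> drop rank exactly if some nonzero complexified tangent vector,
  taken modulo the common kernel of the 17 forms \<open>d\<lambda>\<^sub>1, d\<lambda>\<^sub>2, \<phi>, \<kappa>\<close>, is annihilated by all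
  \<open>\<pi>\<^sup>a\<^sub>i\<^sub>j \<xi>\<^sub>k - \<pi>\<^sup>a\<^sub>i\<^sub>k \<xi>\<^sub>j\<close>. By symmetry in \<open>i, j\<close> this means \<open>\<pi>\<^sup>a\<^sub>i\<^sub>j = c\<^sup>a \<xi>\<^sub>i \<xi>\<^sub>j\<close> there: the tableau
  contains a rank-one element. Comparing entries, \<open>c\<^sup>3\<close> vanishes on \<open>L\<^sub>0\<close>; a nonzero \<open>c\<^sup>1\<close> forces
  \<open>\<lambda>\<^sub>2 = 1\<close> and \<open>\<xi>\<^sub>2 = s \<xi>\<^sub>1, \<xi>\<^sub>4 = - s \<xi>\<^sub>3\<close> with \<open>s = \<plusminus> \<i>\<close>, and \<open>c\<^sup>2\<close> is treated in the same way with
  the indices 2 and 3 of \<open>\<xi>\<close> exchanged and \<open>\<lambda>\<^sub>1\<close> in place of \<open>\<lambda>\<^sub>2\<close>. Conversely, these planes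
  do give rank-one elements when \<open>\<lambda>\<^sub>2 = 1\<close> or \<open>\<lambda>\<^sub>1 = 1\<close>.
\<close>

subsection \<open>Coordinates of the connection forms\<close>

lemma vector_4:
  "(vector [w, x, y, z] :: 'a::zero^4) $ 1 = w"
  "(vector [w, x, y, z] :: 'a^4) $ 2 = x"
  "(vector [w, x, y, z] :: 'a^4) $ 3 = y"
  "(vector [w, x, y, z] :: 'a^4) $ 4 = z"
  by (simp_all add: vector_def)

lemmas austere_S_entries = austere_S_def vector_4 vector_3

text \<open>The entries of \<open>austere_S l\<close> are affine in \<open>l\<close>, so this
  difference is the partial derivative in the direction of the \<open>m\<close>-th parameter, the
  same at every \<open>l\<close>.\<close>

definition d_austere_S :: "3 \<Rightarrow> real^4^4^3" where
  "d_austere_S m = austere_S (axis m 1) - austere_S 0"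

lemma austere_S_affine:
  "austere_S l $ a $ i $ j = austere_S 0 $ a $ i $ j + (\<Sum>m\<in>UNIV. d_austere_S m $ a $ i $ j * l $ m)"
proof -
  have "\<forall>a i j. austere_S l $ a $ i $ j =
      austere_S 0 $ a $ i $ j + (\<Sum>m\<in>UNIV. d_austere_S m $ a $ i $ j * l $ m)"
    by (simp add: forall_3 forall_4 sum_3 d_austere_S_def austere_S_entries axis_def)
  then show ?thesis by blast
qed

lemma frechet_derivative_austere_S:
  "frechet_derivative (\<lambda>y::point. austere_S (snd y) $ a $ i $ j) (at x) =
    (\<lambda>v. \<Sum>m\<in>UNIV. d_austere_S m $ a $ i $ j * snd v $ m)"
proof -
  have "((\<lambda>y::point. austere_S 0 $ a $ i $ j + (\<Sum>m\<in>UNIV. d_austere_S m $ a $ i $ j * snd y $ m))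
      has_derivative (\<lambda>v. \<Sum>m\<in>UNIV. d_austere_S m $ a $ i $ j * snd v $ m)) (at x)"
    by (auto intro!: derivative_eq_intros bounded_linear_imp_has_derivative
        bounded_linear_compose[OF bounded_linear_vec_nth bounded_linear_snd])
  then have "((\<lambda>y::point. austere_S (snd y) $ a $ i $ j)
      has_derivative (\<lambda>v. \<Sum>m\<in>UNIV. d_austere_S m $ a $ i $ j * snd v $ m)) (at x)"
    by (subst austere_S_affine)
  then show ?thesis
    by (rule frechet_derivative_at[symmetric])
qed

lemma pi_form_eq:
  "pi_form a i j x v =
     (\<Sum>m\<in>UNIV. d_austere_S m $ a $ i $ j * snd v $ m)
     - (\<Sum>k\<in>UNIV. austere_S (snd x) $ a $ k $ j * phi_form k i x v)
     - (\<Sum>k\<in>UNIV. austere_S (snd x) $ a $ i $ k * phi_form k j x v)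
     + (\<Sum>b\<in>UNIV. austere_S (snd x) $ b $ i $ j * kappa_form a b x v)"
  by (simp add: pi_form_def frechet_derivative_austere_S mult.commute)

section \<open>Coefficients with respect to a frame\<close>

definition frame_comb :: "frame \<Rightarrow> (real^4) \<times> (real^3) \<Rightarrow> real^7" where
  "frame_comb F c = (\<Sum>i\<in>UNIV. fst c $ i *\<^sub>R fst (snd F) $ i) + (\<Sum>a\<in>UNIV. snd c $ a *\<^sub>R snd (snd F) $ a)"

lemma linear_frame_comb: "linear (frame_comb F)"
  by (rule linearI)
    (simp_all add: frame_comb_def scaleR_add_left sum.distrib scaleR_sum_right add_ac scaleR_add_right)

text \<open>Surjectivity is the spanning condition of \<open>frame_bundle\<close>; injectivity
  follows because both sides have dimension 7. This is what makes the definite description in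
  \<open>frame_coeffs\<close> meaningful.\<close>

lemma bij_frame_comb:
  assumes "F \<in> frame_bundle"
  shows "bij (frame_comb F)"
proof -
  obtain p e \<nu> where F: "F = (p, e, \<nu>)" by (cases F)
  have sp: "span (range (\<lambda>i. e $ i) \<union> range (\<lambda>a. \<nu> $ a)) = UNIV"
    using assms by (simp add: frame_bundle_def F)
  have "e $ i \<in> range (frame_comb F)" for i
    by (rule range_eqI[of _ _ "(axis i 1, 0)"])
      (simp add: frame_comb_def F axis_def if_distrib[of "\<lambda>c. c *\<^sub>R _"] cong: if_cong)
  moreover have "\<nu> $ a \<in> range (frame_comb F)" for a
    by (rule range_eqI[of _ _ "(0, axis a 1)"])
      (simp add: frame_comb_def F axis_def if_distrib[of "\<lambda>c. c *\<^sub>R _"] cong: if_cong)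
  ultimately have "span (range (\<lambda>i. e $ i) \<union> range (\<lambda>a. \<nu> $ a)) \<subseteq> range (frame_comb F)"
    by (intro span_minimal linear_subspace_image linear_frame_comb) auto
  then have s: "surj (frame_comb F)"
    using sp by auto
  have "inj (frame_comb F)"
    by (rule eucl.linear_surjective_imp_injective[OF linear_frame_comb s]) simp
  with s show ?thesis by (simp add: bij_def)
qed

lemma frame_coeffs_eq:
  assumes "F \<in> frame_bundle"
  shows "frame_coeffs F w = c \<longleftrightarrow> frame_comb F c = w"
proof -
  have *: "frame_coeffs F w = (THE c. w = frame_comb F c)"
    by (simp add: frame_coeffs_def frame_comb_def case_prod_beta)
  have "w = frame_comb F d \<longleftrightarrow> d = inv (frame_comb F) w" for d
    using bij_frame_comb[OF assms] by (metis bij_inv_eq_iff)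
  then have "frame_coeffs F w = inv (frame_comb F) w"
    unfolding * by simp
  then show ?thesis
    using bij_inv_eq_iff[OF bij_frame_comb[OF assms]] by metis
qed

lemma linear_frame_coeffs:
  assumes "F \<in> frame_bundle"
  shows "linear (frame_coeffs F)"
proof (rule linearI)
  have c: "frame_comb F (frame_coeffs F w) = w" for w
    using frame_coeffs_eq[OF assms] by blast
  show "frame_coeffs F (u + w) = frame_coeffs F u + frame_coeffs F w" for u w
    by (subst frame_coeffs_eq[OF assms]) (simp add: linear_add[OF linear_frame_comb] c)
  show "frame_coeffs F (r *\<^sub>R w) = r *\<^sub>R frame_coeffs F w" for r w
    by (subst frame_coeffs_eq[OF assms]) (simp add: linear_cmul[OF linear_frame_comb] c)
qed

text \<open>The \<open>e $ i\<close> are orthonormal and orthogonal to the \<open>\<nu> $ a\<close>,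
  so an inner product isolates the coefficient. The \<open>\<nu> $ a\<close> themselves need not be
  orthonormal, so the other coefficients have no such formula.\<close>

lemma fst_frame_coeffs:
  assumes "(p, e, \<nu>) \<in> frame_bundle"
  shows "fst (frame_coeffs (p, e, \<nu>) w) $ j = w \<bullet> e $ j"
proof -
  define c where "c = frame_coeffs (p, e, \<nu>) w"
  have w: "w = (\<Sum>i\<in>UNIV. fst c $ i *\<^sub>R e $ i) + (\<Sum>a\<in>UNIV. snd c $ a *\<^sub>R \<nu> $ a)"
    using frame_coeffs_eq[OF assms, of w c] by (simp add: c_def frame_comb_def)
  have e: "(e $ i) \<bullet> (e $ j) = (if i = j then 1 else 0)" "(\<nu> $ a) \<bullet> (e $ j) = 0" for i j a
    using assms by (auto simp: frame_bundle_def inner_commute)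
  show ?thesis
    unfolding c_def[symmetric] by (subst w) (simp add: e inner_add_left inner_sum_left if_distrib cong: if_cong)
qed

lemma phi_form_skew:
  assumes "fst x \<in> frame_bundle" "v \<in> tangent x"
  shows "phi_form i j x v = - phi_form j i x v"
proof -
  obtain p e \<nu> l where x: "x = ((p, e, \<nu>), l)" by (metis prod.collapse)
  have "(d_e i v) \<bullet> (e $ j) + (e $ i) \<bullet> (d_e j v) = 0"
    using assms(2) by (auto simp: tangent_def frame_tangent_def x d_e_def)
  then show ?thesis
    using assms(1) by (simp add: phi_form_def x fst_frame_coeffs inner_commute)
qed

text \<open>An infinitesimal motion that keeps the base point and turns the \<open>e $ i\<close> and
  the \<open>\<nu> $ a\<close> within their own spans. It realises prescribed values
  \<open>A\<close>, \<open>B\<close>, \<open>l\<close> of the forms \<phi>, \<kappa> and of the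
  parameter differentials, and is tangent when \<open>A\<close> is skew and \<open>l\<close>
  satisfies the linearised equation of \<open>param_L\<close>.\<close>

definition frame_motion :: "frame \<Rightarrow> real^4^4 \<Rightarrow> real^3^3 \<Rightarrow> real^3 \<Rightarrow> point" where
  "frame_motion F A B l = ((0, \<chi> i. \<Sum>j\<in>UNIV. A $ j $ i *\<^sub>R fst (snd F) $ j,
      \<chi> a. \<Sum>b\<in>UNIV. B $ b $ a *\<^sub>R snd (snd F) $ b), l)"

lemma phi_form_frame_motion:
  assumes "fst x \<in> frame_bundle"
  shows "phi_form j i x (frame_motion (fst x) A B l) = A $ j $ i"
proof -
  have "frame_coeffs (fst x) (\<Sum>j\<in>UNIV. A $ j $ i *\<^sub>R fst (snd (fst x)) $ j) = (\<chi> j. A $ j $ i, 0)"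
    by (simp add: frame_coeffs_eq[OF assms] frame_comb_def)
  then show ?thesis
    by (simp add: phi_form_def d_e_def frame_motion_def)
qed

lemma kappa_form_frame_motion:
  assumes "fst x \<in> frame_bundle"
  shows "kappa_form b a x (frame_motion (fst x) A B l) = B $ b $ a"
proof -
  have "frame_coeffs (fst x) (\<Sum>b\<in>UNIV. B $ b $ a *\<^sub>R snd (snd (fst x)) $ b) = (0, \<chi> b. B $ b $ a)"
    by (simp add: frame_coeffs_eq[OF assms] frame_comb_def)
  then show ?thesis
    by (simp add: kappa_form_def d_nu_def frame_motion_def)
qed

lemma frame_motion_tangent:
  assumes "fst x \<in> frame_bundle" "\<And>i j. A $ i $ j = - A $ j $ i" "l \<in> param_tangent (snd x)"
  shows "frame_motion (fst x) A B l \<in> tangent x"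
proof -
  obtain p e \<nu> l0 where x: "x = ((p, e, \<nu>), l0)" by (metis prod.collapse)
  have e: "(e $ i) \<bullet> (e $ j) = (if i = j then 1 else 0)" "(e $ j) \<bullet> (\<nu> $ a) = 0" for i j a
    using assms(1) by (auto simp: frame_bundle_def inner_commute x)
  have "A $ j $ i + A $ i $ j = 0" for i j
    using assms(2)[of i j] by simp
  then show ?thesis
    using assms(3) by (simp add: e x frame_motion_def tangent_def frame_tangent_def
        inner_sum_left inner_sum_right if_distrib cong: if_cong)
qed

subsection \<open>The complexified tableau\<close>

text \<open>The values of the \<open>\<pi>\<close> forms at a complexified tangent vector at which the forms
  \<open>d\<lambda>\<close>, \<open>\<phi>\<close>, \<open>\<kappa>\<close> take the values \<open>\<Lambda>\<close>, \<open>\<Phi>\<close>, \<open>K\<close>.\<close>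

definition pi_poly ::
  "real^3 \<Rightarrow> (3 \<Rightarrow> complex) \<Rightarrow> (4 \<Rightarrow> 4 \<Rightarrow> complex) \<Rightarrow> (3 \<Rightarrow> 3 \<Rightarrow> complex) \<Rightarrow> 3 \<Rightarrow> 4 \<Rightarrow> 4 \<Rightarrow> complex"
where
  "pi_poly l \<Lambda> \<Phi> K a i j =
     (\<Sum>m\<in>UNIV. of_real (d_austere_S m $ a $ i $ j) * \<Lambda> m)
     - (\<Sum>k\<in>UNIV. of_real (austere_S l $ a $ k $ j) * \<Phi> k i)
     - (\<Sum>k\<in>UNIV. of_real (austere_S l $ a $ i $ k) * \<Phi> k j)
     + (\<Sum>b\<in>UNIV. of_real (austere_S l $ b $ i $ j) * K a b)"

text \<open>Each matrix of \<open>austere_S\<close> is symmetric, so exchanging \<open>i\<close> and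
  \<open>j\<close> merely exchanges the two sums over \<Phi>.\<close>

lemma pi_poly_sym: "pi_poly l \<Lambda> \<Phi> K a i j = pi_poly l \<Lambda> \<Phi> K a j i"
proof -
  have S: "austere_S l $ a $ i $ j = austere_S l $ a $ j $ i" for l a i j
  proof -
    have "\<forall>a i j. austere_S l $ a $ i $ j = austere_S l $ a $ j $ i"
      by (simp add: forall_3 forall_4 austere_S_entries)
    then show ?thesis by blast
  qed
  have "d_austere_S m $ a $ i $ j = d_austere_S m $ a $ j $ i" for m
    by (simp add: d_austere_S_def S[of _ a i j])
  moreover have "(\<Sum>k\<in>UNIV. of_real (austere_S l $ a $ i $ k) * \<Phi> k j) =
      (\<Sum>k\<in>UNIV. of_real (austere_S l $ a $ k $ i) * \<Phi> k j)" for i j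
    by (rule sum.cong[OF refl]) (subst S, rule refl)
  ultimately show ?thesis
    by (simp add: pi_poly_def S[of l _ i j])
qed

lemma skew_entries:
  fixes \<Phi> :: "4 \<Rightarrow> 4 \<Rightarrow> complex"
  assumes skew: "\<And>i j. \<Phi> i j = - \<Phi> j i"
  shows "\<Phi> i i = 0" "\<Phi> 1 2 = - \<Phi> 2 1" "\<Phi> 1 3 = - \<Phi> 3 1" "\<Phi> 1 4 = - \<Phi> 4 1"
    "\<Phi> 2 3 = - \<Phi> 3 2" "\<Phi> 2 4 = - \<Phi> 4 2" "\<Phi> 3 4 = - \<Phi> 4 3"
proof -
  show "\<Phi> i i = 0" using skew[of i i] by simp
qed (rule skew)+

text \<open>The entries are listed in pairs prepared for elimination: the two diagonal entries of a
  pair add up to zero and involve a single entry of \<Phi>; the two off-diagonal entries of a pair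
  share a single entry of \<open>K\<close>.\<close>

lemma pi_poly_entries:
  fixes l :: "real^3" and \<Lambda> :: "3 \<Rightarrow> complex" and \<Phi> :: "4 \<Rightarrow> 4 \<Rightarrow> complex" and K :: "3 \<Rightarrow> 3 \<Rightarrow> complex"
  assumes skew: "\<And>i j. \<Phi> i j = - \<Phi> j i"
  defines "P \<equiv> pi_poly l \<Lambda> \<Phi> K" and "l1 \<equiv> of_real (l $ 1)" and "l2 \<equiv> of_real (l $ 2)" and "l3 \<equiv> of_real (l $ 3)"
  shows
    "P 1 1 1 = - 2 * \<Phi> 2 1" "P 1 2 2 = 2 * \<Phi> 2 1"
    "P 1 3 3 = - 2 * l1 * \<Phi> 4 3" "P 1 4 4 = 2 * l1 * \<Phi> 4 3"
    "P 2 1 1 = - 2 * \<Phi> 3 1" "P 2 3 3 = 2 * \<Phi> 3 1"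
    "P 2 2 2 = - 2 * l2 * \<Phi> 4 2" "P 2 4 4 = 2 * l2 * \<Phi> 4 2"
    "P 3 1 1 = - 2 * \<Phi> 4 1" "P 3 4 4 = 2 * \<Phi> 4 1"
    "P 3 2 2 = - 2 * l3 * \<Phi> 3 2" "P 3 3 3 = 2 * l3 * \<Phi> 3 2"
    "P 1 1 2 = K 1 1" "P 1 3 4 = \<Lambda> 1 + l1 * K 1 1"
    "P 1 1 3 = K 1 2 - l1 * \<Phi> 4 1 + \<Phi> 3 2" "P 1 2 4 = l2 * K 1 2 - l1 * \<Phi> 3 2 + \<Phi> 4 1"
    "P 1 1 4 = K 1 3 - l1 * \<Phi> 3 1 + \<Phi> 4 2" "P 1 2 3 = l3 * K 1 3 - l1 * \<Phi> 4 2 + \<Phi> 3 1"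
    "P 2 1 2 = K 2 1 - l2 * \<Phi> 4 1 - \<Phi> 3 2" "P 2 3 4 = l1 * K 2 1 + l2 * \<Phi> 3 2 + \<Phi> 4 1"
    "P 2 1 3 = K 2 2" "P 2 2 4 = \<Lambda> 2 + l2 * K 2 2"
    "P 2 1 4 = K 2 3 - l2 * \<Phi> 2 1 + \<Phi> 4 3" "P 2 2 3 = l3 * K 2 3 + \<Phi> 2 1 - l2 * \<Phi> 4 3"
    "P 3 1 2 = K 3 1 - l3 * \<Phi> 3 1 - \<Phi> 4 2" "P 3 3 4 = l1 * K 3 1 + \<Phi> 3 1 + l3 * \<Phi> 4 2"
    "P 3 1 3 = K 3 2 - l3 * \<Phi> 2 1 - \<Phi> 4 3" "P 3 2 4 = l2 * K 3 2 + \<Phi> 2 1 + l3 * \<Phi> 4 3"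
    "P 3 1 4 = K 3 3" "P 3 2 3 = \<Lambda> 3 + l3 * K 3 3"
  unfolding P_def l1_def l2_def l3_def
  by (simp_all add: skew_entries[of \<Phi>, OF skew] pi_poly_def sum_3 sum_4 d_austere_S_def austere_S_entries axis_def)

section \<open>Linear algebra: ranks, functionals and rank-one matrices\<close>

text \<open>Duality turns a drop of rank into a functional that kills \<open>S\<close> but not all
  of \<open>B\<close>. With \<open>B\<close> the 17 independent forms, such a functional is a
  nonzero complexified tangent vector modulo their common kernel.\<close>

lemma dim_less_card_iff_functional:
  fixes S B :: "('a \<Rightarrow> complex) set"
  assumes S: "S \<subseteq> cfun.span B" and B: "finite B" "cfun.independent B"
  shows "cfun.dim S < card B \<longleftrightarrow>
    (\<exists>g. Vector_Spaces.linear (\<lambda>c f v. c * f v) (*) g \<and> (\<forall>f\<in>S. g f = 0) \<and> (\<exists>b\<in>B. g b \<noteq> 0))"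
    (is "?L \<longleftrightarrow> ?R")
proof -
  interpret p: vector_space_pair "\<lambda>c (f :: 'a \<Rightarrow> complex) v. c * f v" "(*) :: complex \<Rightarrow> _"
    by (intro vector_space_pair.intro cfun.vector_space_axioms vector_space_over_itself.vector_space_axioms)
  obtain C where C: "C \<subseteq> S" "cfun.independent C" "S \<subseteq> cfun.span C" "card C = cfun.dim S"
    using cfun.basis_exists by metis
  have finC: "finite C"
    using cfun.independent_span_bound[OF B(1) C(2)] C(1) S by blast
  show ?thesis
  proof
    assume less: ?L
    have "\<not> B \<subseteq> cfun.span C"
      using cfun.independent_span_bound[OF finC B(2)] less C(4) by linarith
    then obtain b where b: "b \<in> B" "b \<notin> cfun.span C" by blast
    have ind: "cfun.independent (insert b C)"
      by (rule cfun.independent_insertI[OF b(2) C(2)])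
    have "b \<notin> C" using b(2) by (blast intro: cfun.span_base)
    \<comment> \<open>Since \<open>b\<close> lies outside the span of the basis \<open>C\<close> of
      \<open>S\<close>, the values 1 at \<open>b\<close> and 0 on \<open>C\<close> may be prescribed
      and extended linearly.\<close>
    obtain g where g: "Vector_Spaces.linear (\<lambda>c f v. c * f v) (*) g"
        "\<forall>f\<in>insert b C. g f = (if f = b then 1 else 0)"
      using p.linear_independent_extend[OF ind, of "\<lambda>f. if f = b then 1 else 0"] by blast
    have "g f = 0" if "f \<in> C" for f
      using g(2) that \<open>b \<notin> C\<close> by auto
    then have "g f = 0" if "f \<in> S" for f
      by (rule p.linear_eq_0_on_span[OF g(1)]) (use that C(3) in auto)
    moreover have "g b \<noteq> 0"
      using g(2) by simp
    ultimately show ?R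
      using g(1) b(1) by blast
  next
    assume ?R
    then obtain g b where g: "Vector_Spaces.linear (\<lambda>c f v. c * f v) (*) g" "\<forall>f\<in>S. g f = 0"
      and b: "b \<in> B" "g b \<noteq> 0" by blast
    have "b \<notin> cfun.span C"
      using p.linear_eq_0_on_span[OF g(1), of C b] g(2) C(1) b(2) by blast
    then have "b \<notin> C"
      by (blast intro: cfun.span_base)
    have "cfun.independent (insert b C)"
      by (rule cfun.independent_insertI[OF \<open>b \<notin> cfun.span C\<close> C(2)])
    moreover have "insert b C \<subseteq> cfun.span B"
      using b(1) C(1) S cfun.span_base by blast
    ultimately have "card (insert b C) \<le> card B"
      using cfun.independent_span_bound[OF B(1)] by blast
    then show ?L
      using \<open>b \<notin> C\<close> finC C(4) by simp
  qed
qed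

text \<open>Evaluation at \<open>v m\<close> kills the span of all other members of the family, but
  not \<open>\<beta> m\<close>.\<close>

lemma independent_biorthogonal:
  fixes \<beta> :: "'i \<Rightarrow> 'a \<Rightarrow> complex"
  assumes "\<And>m n. m \<in> I \<Longrightarrow> n \<in> I \<Longrightarrow> \<beta> m (v n) = (if m = n then 1 else 0)"
  shows "cfun.independent (\<beta> ` I)" and "inj_on \<beta> I"
proof -
  show "inj_on \<beta> I"
    using assms by (metis inj_onI zero_neq_one)
  have "\<beta> m \<notin> cfun.span (\<beta> ` I - {\<beta> m})" if m: "m \<in> I" for m
  proof
    have "cfun.subspace {f. f (v m) = 0}"
      by (simp add: cfun.subspace_def)
    moreover have "\<beta> ` I - {\<beta> m} \<subseteq> {f. f (v m) = 0}"
      using assms m by auto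
    ultimately have "cfun.span (\<beta> ` I - {\<beta> m}) \<subseteq> {f. f (v m) = 0}"
      by (rule cfun.span_minimal[rotated])
    moreover assume "\<beta> m \<in> cfun.span (\<beta> ` I - {\<beta> m})"
    ultimately show False
      using assms[OF m m] by auto
  qed
  then show "cfun.independent (\<beta> ` I)"
    by (auto simp: cfun.dependent_def)
qed

text \<open>The hypothesis \<open>minors\<close> makes every row of \<open>P\<close> proportional to
  \<open>z\<close>; by symmetry the columns are, too. The pivot \<open>z m\<close> then determines
  the scalar in front of the outer product.\<close>

lemma rank_one_factor:
  fixes P :: "'n \<Rightarrow> 'n \<Rightarrow> 'a::field" and z :: "'n \<Rightarrow> 'a"
  assumes sym: "\<And>i j. P i j = P j i"
    and minors: "\<And>i j k. P i j * z k = P i k * z j"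
    and z: "z m \<noteq> 0"
  shows "P i j = (P m m / (z m)^2) * z i * z j"
proof -
  have "P i j * z m = P i m * z j"
    by (rule minors)
  moreover have "P i m * z m = P m m * z i"
    using sym[of i m] minors[of m i m] by simp
  ultimately have "P i j * (z m)^2 = P m m * z i * z j"
    by (metis (no_types, lifting) mult.assoc mult.commute power2_eq_square)
  then show ?thesis
    using z by (simp add: field_simps)
qed

text \<open>The first two equations give \<open>w2 = \<plusminus> \<i> * w1\<close> and
  \<open>w4 = \<plusminus> \<i> * w3\<close>. Squaring the third forces \<open>r^2 = 1\<close>
  unless \<open>w1\<close> or \<open>w3\<close> vanishes, a case left to the last hypothesis. With
  \<open>r = 1\<close> the third equation makes the two signs opposite; if \<open>w1\<close> or
  \<open>w3\<close> is zero, one sign is free.\<close>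

lemma plane_of_squares:
  fixes w1 w2 w3 w4 :: complex and r :: real
  assumes "w1^2 + w2^2 = 0" "w3^2 + w4^2 = 0" "w2 * w4 = of_real r * w1 * w3" "r > 0"
    and r: "w1 = 0 \<or> w3 = 0 \<Longrightarrow> r = 1"
  shows "r = 1" and "(w2 = \<i> * w1 \<and> w4 = - \<i> * w3) \<or> (w2 = - \<i> * w1 \<and> w4 = \<i> * w3)"
proof -
  have w2: "w2^2 = - (w1^2)" and w4: "w4^2 = - (w3^2)"
    using assms(1,2) by (simp_all add: eq_neg_iff_add_eq_0 add.commute)
  have "(w2 * w4)^2 = w1^2 * w3^2"
    using w2 w4 by (simp add: power_mult_distrib)
  then have "w1^2 * w3^2 * (of_real r ^ 2 - 1) = 0"
    unfolding assms(3) by (simp add: algebra_simps power_mult_distrib)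
  moreover have "r = 1" if "of_real r ^ 2 = (1 :: complex)"
  proof -
    have "r ^ 2 = 1"
      using that by (metis of_real_eq_1_iff of_real_power)
    then show ?thesis
      using assms(4) by (auto simp: power2_eq_1_iff)
  qed
  ultimately show r1: "r = 1"
    using r by auto
  have "(w2 - \<i> * w1) * (w2 + \<i> * w1) = 0" "(w4 - \<i> * w3) * (w4 + \<i> * w3) = 0"
    using w2 w4 by (simp_all add: algebra_simps power2_eq_square)
  then have "w2 = \<i> * w1 \<or> w2 = - \<i> * w1" "w4 = \<i> * w3 \<or> w4 = - \<i> * w3"
    by (auto simp: eq_neg_iff_add_eq_0)
  then show "(w2 = \<i> * w1 \<and> w4 = - \<i> * w3) \<or> (w2 = - \<i> * w1 \<and> w4 = \<i> * w3)"
    using assms(3) r1 by auto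
qed

section \<open>Rank-one elements of the tableau over the parameter surface\<close>

lemma param_L0_facts:
  assumes "l \<in> param_L0"
  shows "l $ 1 > 0" "l $ 2 > 0" "1 + l $ 1 * l $ 2 > 0" "l $ 3 \<noteq> 0"
    and "l $ 3 * (1 + l $ 1 * l $ 2) = - (l $ 1 + l $ 2)"
proof -
  have *: "l $ 1 * l $ 2 * l $ 3 + l $ 1 + l $ 2 + l $ 3 = 0"
    using assms by (simp add: param_L0_def param_L_def)
  show pos: "l $ 1 > 0" "l $ 2 > 0"
    using assms by (auto simp: param_L0_def)
  then show "1 + l $ 1 * l $ 2 > 0"
    by (simp add: add_pos_pos)
  show eq: "l $ 3 * (1 + l $ 1 * l $ 2) = - (l $ 1 + l $ 2)"
    using * by (simp add: algebra_simps)
  then show "l $ 3 \<noteq> 0"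
    using pos by auto
qed

text \<open>Multiplying the first equation by \<open>r\<close> and replacing \<open>r * t\<close> by
  -1 cancels \<open>s\<close> and leaves \<open>r^2 = 1\<close>. Here \<open>t\<close> will be the
  third parameter and \<open>r\<close> one of the first two.\<close>

lemma unit_of_reciprocal:
  fixes r s t :: real
  assumes "t * (1 + s * r) = - (s + r)" "1 + r * t = 0" "r > 0"
  shows "r = 1"
proof -
  have "r ^ 2 = 1"
    using assms(1,2) by algebra
  then show ?thesis
    using assms(3) by (auto simp: power2_eq_1_iff)
qed

text \<open>Used with \<open>(i, j)\<close> equal to (2, 3) when \<open>l $ 2 = 1\<close> and to (3,
  2) when \<open>l $ 1 = 1\<close>, with \<open>s\<close> a square root of -1. The coordinates
  \<open>z $ 1\<close> and \<open>z $ j\<close> are free.\<close>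

definition char_plane :: "4 \<Rightarrow> 4 \<Rightarrow> complex \<Rightarrow> (complex^4) set" where
  "char_plane i j s = {z. z $ i = s * z $ 1 \<and> z $ 4 = - s * z $ j}"

text \<open>The diagonal entries of \<open>c\<^sup>a z\<^sub>i z\<^sub>j\<close> determine \<open>\<Phi>\<close> twice, which gives \<open>t1\<close> to \<open>t6\<close>;
  eliminating \<open>K\<close> from the other entries gives \<open>q12\<close> to \<open>q32\<close> and \<open>tg\<close>. If \<open>c 3 \<noteq> 0\<close>, the
  equations force \<open>l1 * l2 = -1\<close> or \<open>z = 0\<close>.\<close>

lemma rank_one_in_tableau:
  assumes l: "l \<in> param_L0"
    and skew: "\<And>i j. \<Phi> i j = - \<Phi> j i"
    and tang: "\<Lambda> 1 * (1 + of_real (l $ 2 * l $ 3)) + \<Lambda> 2 * (1 + of_real (l $ 1 * l $ 3))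
       + \<Lambda> 3 * (1 + of_real (l $ 1 * l $ 2)) = 0"
    and minors: "\<And>a i j k. pi_poly l \<Lambda> \<Phi> K a i j * z $ k = pi_poly l \<Lambda> \<Phi> K a i k * z $ j"
    and "z \<noteq> 0"
    and nz: "(\<exists>m. \<Lambda> m \<noteq> 0) \<or> (\<exists>i j. \<Phi> i j \<noteq> 0) \<or> (\<exists>a b. K a b \<noteq> 0)"
  shows "(l $ 2 = 1 \<and> z \<in> char_plane 2 3 \<i> \<union> char_plane 2 3 (- \<i>)) \<or>
         (l $ 1 = 1 \<and> z \<in> char_plane 3 2 \<i> \<union> char_plane 3 2 (- \<i>))"
proof -
  define l1 l2 l3 :: complex
    where "l1 = of_real (l $ 1)" and "l2 = of_real (l $ 2)" and "l3 = of_real (l $ 3)"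
  note L = param_L0_facts[OF l]
  have l_nz: "l1 \<noteq> 0" "l2 \<noteq> 0" "l3 \<noteq> 0"
    using L by (simp_all add: l1_def l2_def l3_def)
  have l12: "1 + l1 * l2 \<noteq> 0"
    using L(3) unfolding l1_def l2_def by (metis of_real_1 of_real_add of_real_eq_0_iff of_real_mult less_irrefl)
  have rel: "l3 * (1 + l1 * l2) = - (l1 + l2)"
    unfolding l1_def l2_def l3_def using arg_cong[OF L(5), of complex_of_real] by simp
  define x1 x2 x3 x4 where "x1 = z $ 1" and "x2 = z $ 2" and "x3 = z $ 3" and "x4 = z $ 4"
  have x_nz: "x1 \<noteq> 0 \<or> x2 \<noteq> 0 \<or> x3 \<noteq> 0 \<or> x4 \<noteq> 0"
    using \<open>z \<noteq> 0\<close> by (auto simp: x1_def x2_def x3_def x4_def vec_eq_iff forall_4)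
  obtain m where m: "z $ m \<noteq> 0"
    using \<open>z \<noteq> 0\<close> by (auto simp: vec_eq_iff)
  define c where "c a = pi_poly l \<Lambda> \<Phi> K a m m / (z $ m)^2" for a
  have P: "pi_poly l \<Lambda> \<Phi> K a i j = c a * z $ i * z $ j" for a i j
    unfolding c_def by (rule rank_one_factor[of _ "\<lambda>i. z $ i"]) (rule pi_poly_sym minors m)+
  note e = pi_poly_entries[of \<Phi> l \<Lambda> K, OF skew, folded l1_def l2_def l3_def,
      unfolded P, folded x1_def x2_def x3_def x4_def]
  have t1: "c 1 * (x1^2 + x2^2) = 0" using e(1,2) by algebra
  have t2: "c 1 * (x3^2 + x4^2) = 0" using e(3,4) by algebra
  have t3: "c 2 * (x1^2 + x3^2) = 0" using e(5,6) by algebra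
  have t4: "c 2 * (x2^2 + x4^2) = 0" using e(7,8) by algebra
  have t5: "c 3 * (x1^2 + x4^2) = 0" using e(9,10) by algebra
  have t6: "c 3 * (x2^2 + x3^2) = 0" using e(11,12) by algebra
  \<comment> \<open>Subtracting \<open>l2\<close> times entry 13 of the first matrix from its entry
    24 removes \<open>K 1 2\<close>. By \<open>rel\<close> the rest is
    \<open>(1 + l1 * l2) * (\<Phi> 4 1 + l3 * \<Phi> 3 2)\<close>, and entries 11 and 22 of the
    third matrix express it by \<open>c 3\<close>. The next three equations remove
    \<open>K 2 1\<close>, \<open>K 3 1\<close> and \<open>K 3 2\<close> in the same way.\<close>
  have q12: "2 * c 1 * (x2 * x4 - l2 * x1 * x3) = - (1 + l1 * l2) * (c 3 * (x1^2 + x2^2))"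
    using e(15,16,9,11) rel by algebra
  have q21: "2 * c 2 * (x3 * x4 - l1 * x1 * x2) = - (1 + l1 * l2) * (c 3 * (x1^2 - x2^2))"
    using e(19,20,9,11) rel by algebra
  have q31: "2 * c 3 * (x3 * x4 - l1 * x1 * x2) = - (1 + l1 * l3) * (c 2 * (x1^2 - x2^2))"
    using e(25,26,5,7) rel by algebra
  have q32: "2 * c 3 * (x2 * x4 - l2 * x1 * x3) = - (1 + l2 * l3) * (c 1 * (x1^2 - x3^2))"
    using e(27,28,1,3) rel by algebra
  \<comment> \<open>The pair of entries containing \<open>K m m\<close> yields
    \<open>\<Lambda> m\<close>, and these values are put into the linearised equation of the
    parameter surface.\<close>
  have tg: "(1 + l2 * l3) * c 1 * (x3 * x4 - l1 * x1 * x2) + (1 + l1 * l3) * c 2 * (x2 * x4 - l2 * x1 * x3)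
      + (1 + l1 * l2) * c 3 * (x2 * x3 - l3 * x1 * x4) = 0"
  proof -
    have "\<Lambda> 1 = c 1 * (x3 * x4 - l1 * x1 * x2)"
      using e(13,14) by (simp add: algebra_simps)
    moreover have "\<Lambda> 2 = c 2 * (x2 * x4 - l2 * x1 * x3)"
      using e(21,22) by (simp add: algebra_simps)
    moreover have "\<Lambda> 3 = c 3 * (x2 * x3 - l3 * x1 * x4)"
      using e(29,30) by (simp add: algebra_simps)
    ultimately show ?thesis
      using tang by (simp add: l1_def l2_def l3_def mult_ac)
  qed
  have c3: "c 3 = 0"
  proof (rule ccontr)
    assume c3: "c 3 \<noteq> 0"
    have x14: "x4^2 = - (x1^2)" and x23: "x3^2 = - (x2^2)"
      using c3 t5 t6 by (simp_all add: eq_neg_iff_add_eq_0 add.commute)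
    have "c 2 * (x1^2 - x2^2) = 0" "c 1 * (x1^2 - x3^2) = 0"
      using t3 t1 x23 by algebra+
    then have a: "x3 * x4 = l1 * x1 * x2" and b: "x2 * x4 = l2 * x1 * x3"
      using q31 q32 c3 by auto
    have "x3 * x4^2 = l1 * x1 * (x2 * x4)"
      using a by (simp add: power2_eq_square algebra_simps)
    then have "x3 * x1^2 * (1 + l1 * l2) = 0"
      unfolding b x14 by (simp add: power2_eq_square algebra_simps neg_eq_iff_add_eq_0)
    then have "x1 = 0 \<or> x3 = 0"
      using l12 by auto
    \<comment> \<open>\<open>x1\<close> and \<open>x4\<close> vanish together, and so do
      \<open>x2\<close> and \<open>x3\<close>; exactly one pair survives. Then \<open>c 1\<close>
      and \<open>c 2\<close> vanish and \<open>tg\<close> equates a zero product with a nonzero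
      one.\<close>
    then have cases: "x1 = 0 \<and> x4 = 0 \<and> x2 \<noteq> 0 \<and> x3 \<noteq> 0 \<or> x2 = 0 \<and> x3 = 0 \<and> x1 \<noteq> 0 \<and> x4 \<noteq> 0"
      using x14 x23 x_nz by auto
    then have "c 1 = 0" "c 2 = 0"
      using t1 t3 by auto
    then have "x2 * x3 - l3 * x1 * x4 = 0"
      using tg c3 l12 by simp
    with cases l_nz show False
      by auto
  qed
  have case1: ?thesis if c1: "c 1 \<noteq> 0"
  proof -
    have s1: "x1^2 + x2^2 = 0" and s2: "x3^2 + x4^2 = 0"
      using t1 t2 c1 by simp_all
    have s3: "x2 * x4 = of_real (l $ 2) * x1 * x3"
      using q12 c1 c3 by (simp add: l2_def)
    \<comment> \<open>Here \<open>s3\<close> says nothing about \<open>l $ 2\<close>. But exactly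
      one of the pairs \<open>x1, x2\<close> and \<open>x3, x4\<close> vanishes, so
      \<open>t3\<close> gives \<open>c 2 = 0\<close>, and \<open>tg\<close> reduces to
      \<open>1 + l2 * l3 = 0\<close>.\<close>
    have s4: "l $ 2 = 1" if "x1 = 0 \<or> x3 = 0"
    proof -
      have *: "x1 = 0 \<and> x2 = 0 \<and> x3 \<noteq> 0 \<and> x4 \<noteq> 0 \<or> x3 = 0 \<and> x4 = 0 \<and> x1 \<noteq> 0 \<and> x2 \<noteq> 0"
        using that s1 s2 x_nz by auto
      then have "c 2 = 0"
        using t3 by auto
      then have "1 + l2 * l3 = 0"
        using * tg c1 c3 l_nz by auto
      then have "1 + l $ 2 * l $ 3 = 0"
        unfolding l2_def l3_def by (metis of_real_1 of_real_add of_real_eq_0_iff of_real_mult)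
      then show ?thesis
        using unit_of_reciprocal[OF L(5)] L(2) by blast
    qed
    show ?thesis
      using plane_of_squares[OF s1 s2 s3 L(2) s4]
      by (auto simp: char_plane_def x1_def x2_def x3_def x4_def)
  qed
  have case2: ?thesis if c2: "c 2 \<noteq> 0"
  proof -
    have s1: "x1^2 + x3^2 = 0" and s2: "x2^2 + x4^2 = 0"
      using t3 t4 c2 by simp_all
    have s3: "x3 * x4 = of_real (l $ 1) * x1 * x2"
      using q21 c2 c3 by (simp add: l1_def)
    have s4: "l $ 1 = 1" if "x1 = 0 \<or> x2 = 0"
    proof -
      have *: "x1 = 0 \<and> x3 = 0 \<and> x2 \<noteq> 0 \<and> x4 \<noteq> 0 \<or> x2 = 0 \<and> x4 = 0 \<and> x1 \<noteq> 0 \<and> x3 \<noteq> 0"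
        using that s1 s2 x_nz by auto
      then have "c 1 = 0"
        using t1 by auto
      then have "1 + l1 * l3 = 0"
        using * tg c2 c3 l_nz by auto
      then have "1 + l $ 1 * l $ 3 = 0"
        unfolding l1_def l3_def by (metis of_real_1 of_real_add of_real_eq_0_iff of_real_mult)
      then show ?thesis
        using unit_of_reciprocal[of "l $ 3" "l $ 2" "l $ 1"] L(1,5) by (simp add: mult.commute add.commute)
    qed
    show ?thesis
      using plane_of_squares[OF s1 s2 s3 L(1) s4]
      by (auto simp: char_plane_def x1_def x2_def x3_def x4_def)
  qed
  \<comment> \<open>If all \<open>c a\<close> vanish, the diagonal entries give
    \<open>\<Phi> = 0\<close>, and the others then give \<open>K = 0\<close> and
    \<open>\<Lambda> = 0\<close>. Dually, the \<pi> forms have full rank 17.\<close>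
  have "c 1 \<noteq> 0 \<or> c 2 \<noteq> 0"
  proof (rule ccontr)
    assume "\<not> (c 1 \<noteq> 0 \<or> c 2 \<noteq> 0)"
    then have c0: "c 1 = 0" "c 2 = 0" "c 3 = 0"
      using c3 by auto
    note e0 = e[unfolded c0, simplified]
    have \<Phi>0: "\<Phi> 2 1 = 0" "\<Phi> 3 1 = 0" "\<Phi> 4 1 = 0" "\<Phi> 3 2 = 0" "\<Phi> 4 2 = 0" "\<Phi> 4 3 = 0"
      using e0 l_nz by simp_all
    have "\<forall>i j. \<Phi> i j = 0"
      by (simp add: forall_4 skew_entries[of \<Phi>, OF skew] \<Phi>0)
    moreover have "\<forall>a b. K a b = 0" "\<forall>m. \<Lambda> m = 0"
      using e0 \<Phi>0 by (simp_all add: forall_3)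
    ultimately show False
      using nz by blast
  qed
  then show ?thesis
    using case1 case2 by blast
qed

text \<open>The witnesses come from solving \<open>pi_poly_entries\<close> backwards, with
  \<open>c\<close> equal to (1, 0, 0) if \<open>l $ 2 = 1\<close> and to (0, 1, 0) if
  \<open>l $ 1 = 1\<close>. In both cases \<open>l $ 3 = -1\<close>, so the coefficient of the only
  nonzero \<open>\<Lambda> m\<close> in the linearised equation is zero.\<close>

lemma rank_one_in_tableau_exists:
  assumes l: "l \<in> param_L0" and "z \<noteq> 0" and s: "s^2 = -1"
    and z: "l $ 2 = 1 \<and> z \<in> char_plane 2 3 s \<or> l $ 1 = 1 \<and> z \<in> char_plane 3 2 s"
  obtains \<Phi> \<Lambda> K where
    "\<And>i j. \<Phi> i j = - \<Phi> j i"
    "\<Lambda> 1 * (1 + of_real (l $ 2 * l $ 3)) + \<Lambda> 2 * (1 + of_real (l $ 1 * l $ 3))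
       + \<Lambda> 3 * (1 + of_real (l $ 1 * l $ 2)) = 0"
    "\<And>a i j k. pi_poly l \<Lambda> \<Phi> K a i j * z $ k = pi_poly l \<Lambda> \<Phi> K a i k * z $ j"
    "\<exists>i j. \<Phi> i j \<noteq> 0"
proof -
  note result = that
  note L = param_L0_facts[OF l]
  have ss: "s * u * (s * w) = - (u * w)" for u w
    using s by (simp add: power2_eq_square mult_ac) (metis mult.assoc mult_minus1)
  \<comment> \<open>By symmetry ten entries of each matrix suffice, and an outer product satisfies
    the equations between minors.\<close>
  have outer: thesis
    if skew: "\<And>i j. \<Phi> i j = - \<Phi> j i"
      and tang: "\<Lambda> 1 * (1 + of_real (l $ 2 * l $ 3)) + \<Lambda> 2 * (1 + of_real (l $ 1 * l $ 3))
       + \<Lambda> 3 * (1 + of_real (l $ 1 * l $ 2)) = 0"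
      and nz: "\<exists>i j. \<Phi> i j \<noteq> 0"
      and P: "\<forall>a. pi_poly l \<Lambda> \<Phi> K a 1 1 = c a * z $ 1 * z $ 1 \<and> pi_poly l \<Lambda> \<Phi> K a 2 2 = c a * z $ 2 * z $ 2 \<and>
        pi_poly l \<Lambda> \<Phi> K a 3 3 = c a * z $ 3 * z $ 3 \<and> pi_poly l \<Lambda> \<Phi> K a 4 4 = c a * z $ 4 * z $ 4 \<and>
        pi_poly l \<Lambda> \<Phi> K a 1 2 = c a * z $ 1 * z $ 2 \<and> pi_poly l \<Lambda> \<Phi> K a 1 3 = c a * z $ 1 * z $ 3 \<and>
        pi_poly l \<Lambda> \<Phi> K a 1 4 = c a * z $ 1 * z $ 4 \<and> pi_poly l \<Lambda> \<Phi> K a 2 3 = c a * z $ 2 * z $ 3 \<and>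
        pi_poly l \<Lambda> \<Phi> K a 2 4 = c a * z $ 2 * z $ 4 \<and> pi_poly l \<Lambda> \<Phi> K a 3 4 = c a * z $ 3 * z $ 4"
    for \<Phi> \<Lambda> K c
  proof (rule result[of \<Phi> \<Lambda> K, OF skew tang _ nz])
    have "\<forall>i j. pi_poly l \<Lambda> \<Phi> K a i j = c a * z $ i * z $ j" for a
      using P[rule_format, of a] pi_poly_sym[of l \<Lambda> \<Phi> K a 2 1] pi_poly_sym[of l \<Lambda> \<Phi> K a 3 1]
        pi_poly_sym[of l \<Lambda> \<Phi> K a 4 1] pi_poly_sym[of l \<Lambda> \<Phi> K a 3 2]
        pi_poly_sym[of l \<Lambda> \<Phi> K a 4 2] pi_poly_sym[of l \<Lambda> \<Phi> K a 4 3]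
      by (simp add: forall_4)
    then show "pi_poly l \<Lambda> \<Phi> K a i j * z $ k = pi_poly l \<Lambda> \<Phi> K a i k * z $ j" for a i j k
      by simp
  qed
  show thesis
    using z
  proof
    assume asm: "l $ 2 = 1 \<and> z \<in> char_plane 2 3 s"
    define x y where "x = z $ 1" and "y = z $ 3"
    have zx: "z $ 1 = x" "z $ 2 = s * x" "z $ 3 = y" "z $ 4 = - s * y"
      using asm by (simp_all add: char_plane_def x_def y_def)
    have l2: "l $ 2 = 1"
      using asm by simp
    have "(l $ 3 + 1) * (1 + l $ 1) = 0"
      using L(5) l2 by (simp add: algebra_simps)
    then have l3: "l $ 3 = -1"
      using L(1) by (simp add: add_eq_0_iff)
    \<comment> \<open>The values of \<open>\<Phi> 2 1\<close> and \<open>\<Phi> 4 3\<close> forced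
      by entries 11 and 33 of the first matrix.\<close>
    define p q where "p = - (x^2) / 2" and "q = - (y^2) / (2 * of_real (l $ 1))"
    define \<Phi> :: "4 \<Rightarrow> 4 \<Rightarrow> complex" where
      "\<Phi> i j = (if (i, j) = (2, 1) then p else if (i, j) = (1, 2) then - p
          else if (i, j) = (4, 3) then q else if (i, j) = (3, 4) then - q else 0)" for i j
    define \<Lambda> :: "3 \<Rightarrow> complex" where
      "\<Lambda> m = (if m = 1 then z $ 3 * z $ 4 - of_real (l $ 1) * z $ 1 * z $ 2 else 0)" for m
    \<comment> \<open>The first row reproduces entries 12, 13 and 14 of the outer product;
      \<open>K 2 3\<close> and \<open>K 3 2\<close> cancel the contributions of \<Phi> to the second
      and third matrices.\<close>
    define K :: "3 \<Rightarrow> 3 \<Rightarrow> complex" where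
      "K a b = (if a = 1 then x * (if b = 1 then z $ 2 else if b = 2 then z $ 3 else z $ 4)
          else if (a, b) = (2, 3) then p - q else if (a, b) = (3, 2) then q - p else 0)" for a b
    have skew: "\<Phi> i j = - \<Phi> j i" for i j
      by (auto simp: \<Phi>_def)
    have "x \<noteq> 0 \<or> y \<noteq> 0"
      using \<open>z \<noteq> 0\<close> zx by (auto simp: vec_eq_iff forall_4)
    then have "\<Phi> 2 1 \<noteq> 0 \<or> \<Phi> 4 3 \<noteq> 0"
      using L(1) by (auto simp: \<Phi>_def p_def q_def)
    then have nz: "\<exists>i j. \<Phi> i j \<noteq> 0"
      by blast
    show thesis
      using L(1)
      by (intro outer[of \<Phi> \<Lambda> K "\<lambda>a. if a = 1 then 1 else 0", OF skew _ nz])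
        (auto simp: forall_3 pi_poly_entries[of \<Phi>, OF skew] \<Lambda>_def l2 l3 K_def \<Phi>_def p_def q_def zx
          power2_eq_square ss)
  next
    assume asm: "l $ 1 = 1 \<and> z \<in> char_plane 3 2 s"
    define x y where "x = z $ 1" and "y = z $ 2"
    have zx: "z $ 1 = x" "z $ 3 = s * x" "z $ 2 = y" "z $ 4 = - s * y"
      using asm by (simp_all add: char_plane_def x_def y_def)
    have l1: "l $ 1 = 1"
      using asm by simp
    have "(l $ 3 + 1) * (1 + l $ 2) = 0"
      using L(5) l1 by (simp add: algebra_simps)
    then have l3: "l $ 3 = -1"
      using L(2) by (simp add: add_eq_0_iff)
    \<comment> \<open>Now \<open>\<Phi> 3 1\<close> and \<open>\<Phi> 4 2\<close>, forced by entries
      11 and 22 of the second matrix.\<close>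
    define p q where "p = - (x^2) / 2" and "q = - (y^2) / (2 * of_real (l $ 2))"
    define \<Phi> :: "4 \<Rightarrow> 4 \<Rightarrow> complex" where
      "\<Phi> i j = (if (i, j) = (3, 1) then p else if (i, j) = (1, 3) then - p
          else if (i, j) = (4, 2) then q else if (i, j) = (2, 4) then - q else 0)" for i j
    define \<Lambda> :: "3 \<Rightarrow> complex" where
      "\<Lambda> m = (if m = 2 then z $ 2 * z $ 4 - of_real (l $ 2) * z $ 1 * z $ 3 else 0)" for m
    define K :: "3 \<Rightarrow> 3 \<Rightarrow> complex" where
      "K a b = (if a = 2 then x * (if b = 1 then z $ 2 else if b = 2 then z $ 3 else z $ 4)
          else if (a, b) = (1, 3) then p - q else if (a, b) = (3, 1) then q - p else 0)" for a b
    have skew: "\<Phi> i j = - \<Phi> j i" for i j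
      by (auto simp: \<Phi>_def)
    have "x \<noteq> 0 \<or> y \<noteq> 0"
      using \<open>z \<noteq> 0\<close> zx by (auto simp: vec_eq_iff forall_4)
    then have "\<Phi> 3 1 \<noteq> 0 \<or> \<Phi> 4 2 \<noteq> 0"
      using L(2) by (auto simp: \<Phi>_def p_def q_def)
    then have nz: "\<exists>i j. \<Phi> i j \<noteq> 0"
      by blast
    show thesis
      using L(2)
      by (intro outer[of \<Phi> \<Lambda> K "\<lambda>a. if a = 2 then 1 else 0", OF skew _ nz])
        (auto simp: forall_3 pi_poly_entries[of \<Phi>, OF skew] \<Lambda>_def l1 l3 K_def \<Phi>_def p_def q_def zx
          power2_eq_square ss)
  qed
qed

section \<open>Forms on the tangent space and functionals on them\<close>

text \<open>Extension by zero, as in \<open>polar_forms\<close>, turns relations that hold only on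
  tangent vectors into equations between elements of one complex vector space.\<close>

definition tangent_form :: "point \<Rightarrow> (point \<Rightarrow> real) \<Rightarrow> point \<Rightarrow> complex" where
  "tangent_form x f = (\<lambda>v. if v \<in> tangent x then of_real (f v) else 0)"

lemma tangent_form_pi:
  "tangent_form x (pi_form a i j x) =
     (\<Sum>m\<in>UNIV. (\<lambda>v. of_real (d_austere_S m $ a $ i $ j) * tangent_form x (\<lambda>v. snd v $ m) v))
     - (\<Sum>k\<in>UNIV. (\<lambda>v. of_real (austere_S (snd x) $ a $ k $ j) * tangent_form x (phi_form k i x) v))
     - (\<Sum>k\<in>UNIV. (\<lambda>v. of_real (austere_S (snd x) $ a $ i $ k) * tangent_form x (phi_form k j x) v))
     + (\<Sum>b\<in>UNIV. (\<lambda>v. of_real (austere_S (snd x) $ b $ i $ j) * tangent_form x (kappa_form a b x) v))"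
  by (rule ext) (simp add: tangent_form_def pi_form_eq sum_3 sum_4)

text \<open>A functional on forms acts as a complexified tangent vector: its values on the \<pi>
  forms depend only on those on the parameter differentials, \<phi> and \<kappa>.\<close>

lemma linear_tangent_form_pi:
  assumes "Vector_Spaces.linear (\<lambda>c (f :: point \<Rightarrow> complex) v. c * f v) (*) g"
  shows "g (tangent_form x (pi_form a i j x)) =
    pi_poly (snd x) (\<lambda>m. g (tangent_form x (\<lambda>v. snd v $ m))) (\<lambda>i j. g (tangent_form x (phi_form i j x)))
      (\<lambda>a b. g (tangent_form x (kappa_form a b x))) a i j"
proof -
  interpret g: Vector_Spaces.linear "\<lambda>c (f :: point \<Rightarrow> complex) v. c * f v" "(*)" g
    by (rule assms)
  show ?thesis
    by (simp add: tangent_form_pi pi_poly_def g.add g.diff g.sum g.scale)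
qed

lemma tangent_form_skew:
  assumes "fst x \<in> frame_bundle"
  shows "tangent_form x (phi_form i j x) = - tangent_form x (phi_form j i x)"
  using phi_form_skew[OF assms, of _ i j] by (auto simp: tangent_form_def fun_eq_iff)

lemma tangent_form_param:
  "(\<lambda>v. of_real (1 + snd x $ 2 * snd x $ 3) * tangent_form x (\<lambda>v. snd v $ 1) v)
    + (\<lambda>v. of_real (1 + snd x $ 1 * snd x $ 3) * tangent_form x (\<lambda>v. snd v $ 2) v)
    + (\<lambda>v. of_real (1 + snd x $ 1 * snd x $ 2) * tangent_form x (\<lambda>v. snd v $ 3) v) = 0"
proof (rule ext)
  fix v
  have "v \<in> tangent x \<Longrightarrow> (1 + snd x $ 2 * snd x $ 3) * snd v $ 1 + (1 + snd x $ 1 * snd x $ 3) * snd v $ 2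
      + (1 + snd x $ 1 * snd x $ 2) * snd v $ 3 = 0"
    by (auto simp: tangent_def param_tangent_def algebra_simps)
  from this[THEN arg_cong[of _ _ complex_of_real]]
  show "((\<lambda>v. of_real (1 + snd x $ 2 * snd x $ 3) * tangent_form x (\<lambda>v. snd v $ 1) v)
    + (\<lambda>v. of_real (1 + snd x $ 1 * snd x $ 3) * tangent_form x (\<lambda>v. snd v $ 2) v)
    + (\<lambda>v. of_real (1 + snd x $ 1 * snd x $ 2) * tangent_form x (\<lambda>v. snd v $ 3) v)) v = 0 v"
    by (auto simp: tangent_form_def)
qed

text \<open>The functional is evaluation at a complex tangent vector: real and imaginary parts of
  the prescribed values are realised by two frame motions, and \<open>g\<close> combines the values
  there with the factor \<open>\<i>\<close>.\<close>

lemma tangent_functional_exists: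
  assumes x: "fst x \<in> frame_bundle" and skew: "\<And>i j. \<Phi> i j = - \<Phi> j i"
    and tang: "\<Lambda> 1 * (1 + of_real (snd x $ 2 * snd x $ 3)) + \<Lambda> 2 * (1 + of_real (snd x $ 1 * snd x $ 3))
       + \<Lambda> 3 * (1 + of_real (snd x $ 1 * snd x $ 2)) = 0"
  obtains g where "Vector_Spaces.linear (\<lambda>c (f :: point \<Rightarrow> complex) v. c * f v) (*) g"
    "\<And>m. g (tangent_form x (\<lambda>v. snd v $ m)) = \<Lambda> m"
    "\<And>i j. g (tangent_form x (phi_form i j x)) = \<Phi> i j"
    "\<And>a b. g (tangent_form x (kappa_form a b x)) = K a b"
proof -
  define v where "v h = frame_motion (fst x) (\<chi> i j. h (\<Phi> i j)) (\<chi> a b. h (K a b)) (\<chi> m. h (\<Lambda> m))"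
    for h :: "complex \<Rightarrow> real"
  define g where "g f = f (v Re) + \<i> * f (v Im)" for f :: "point \<Rightarrow> complex"
  have Re: "Re (\<Phi> i j) = - Re (\<Phi> j i)" and Im: "Im (\<Phi> i j) = - Im (\<Phi> j i)" for i j
    by (subst skew, simp)+
  have dl: "(\<chi> m. Re (\<Lambda> m)) \<in> param_tangent (snd x)" "(\<chi> m. Im (\<Lambda> m)) \<in> param_tangent (snd x)"
    using arg_cong[OF tang, of Re] arg_cong[OF tang, of Im]
    by (simp_all add: param_tangent_def algebra_simps)
  have v: "v Re \<in> tangent x" "v Im \<in> tangent x"
    unfolding v_def by (rule frame_motion_tangent[OF x], simp only: vec_lambda_beta, rule Re Im, rule dl)+
  show ?thesis
  proof
    show "Vector_Spaces.linear (\<lambda>c (f :: point \<Rightarrow> complex) v. c * f v) (*) g"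
      using cfun.vector_space_axioms vector_space_over_itself.vector_space_axioms
      by (simp add: Vector_Spaces.linear_iff g_def algebra_simps)
    show "g (tangent_form x (\<lambda>v. snd v $ m)) = \<Lambda> m" for m
      using v by (simp add: g_def tangent_form_def) (simp add: v_def frame_motion_def complex_eq_iff)
    show "g (tangent_form x (phi_form i j x)) = \<Phi> i j" for i j
      using v by (simp add: g_def tangent_form_def) (simp add: v_def phi_form_frame_motion[OF x] complex_eq_iff)
    show "g (tangent_form x (kappa_form a b x)) = K a b" for a b
      using v by (simp add: g_def tangent_form_def) (simp add: v_def kappa_form_frame_motion[OF x] complex_eq_iff)
  qed
qed

subsection \<open>The rank of the polar equations\<close>

text \<open>Listed explicitly because in type \<open>4\<close> the index 4 equals 0 and is the least
  element of the order.\<close>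

definition below_diagonal :: "(4 \<times> 4) set" where
  "below_diagonal = {(2, 1), (3, 1), (4, 1), (3, 2), (4, 2), (4, 3)}"

lemma below_diagonal_asym: "(i, j) \<in> below_diagonal \<Longrightarrow> (j, i) \<notin> below_diagonal"
proof -
  have "\<forall>i j. (i, j) \<in> below_diagonal \<longrightarrow> (j, i) \<notin> below_diagonal"
    by (simp add: forall_4 below_diagonal_def)
  then show "(i, j) \<in> below_diagonal \<Longrightarrow> (j, i) \<notin> below_diagonal" by blast
qed

lemma below_diagonal_cases: "i = j \<or> (i, j) \<in> below_diagonal \<or> (j, i) \<in> below_diagonal"
proof -
  have "\<forall>i j. i = j \<or> (i, j) \<in> below_diagonal \<or> (j, i) \<in> below_diagonal"
    by (simp add: forall_4 below_diagonal_def)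
  then show ?thesis by blast
qed

text \<open>The summands index the parameter differentials, \<phi> and \<kappa>, which contribute 2
  + 6 + 9 = 17 forms.\<close>

definition coframe_index :: "(3 + 4 \<times> 4 + 3 \<times> 3) set" where
  "coframe_index = Inl ` {1, 2} \<union>
     (Inr \<circ> Inl) ` below_diagonal \<union> (Inr \<circ> Inr) ` UNIV"

definition coframe :: "point \<Rightarrow> 3 + 4 \<times> 4 + 3 \<times> 3 \<Rightarrow> point \<Rightarrow> complex" where
  "coframe x n = tangent_form x (case n of Inl m \<Rightarrow> (\<lambda>v. snd v $ m)
     | Inr (Inl (i, j)) \<Rightarrow> phi_form i j x | Inr (Inr (a, b)) \<Rightarrow> kappa_form a b x)"

lemma card_coframe_index: "finite coframe_index" "card coframe_index = 17"
proof -
  show "finite coframe_index"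
    by (simp add: coframe_index_def below_diagonal_def)
  have "card coframe_index = card (Inl ` {1, 2} \<union>
     (Inr \<circ> Inl) ` below_diagonal :: (3 + 4 \<times> 4 + 3 \<times> 3) set)
     + card ((Inr \<circ> Inr) ` UNIV :: (3 + 4 \<times> 4 + 3 \<times> 3) set)"
    unfolding coframe_index_def by (rule card_Un_disjoint) auto
  also have "card ((Inr \<circ> Inr) ` UNIV :: (3 + 4 \<times> 4 + 3 \<times> 3) set) = 9"
    by (subst card_image) (auto simp: inj_on_def)
  also have "card (Inl ` {1, 2} \<union>
     (Inr \<circ> Inl) ` below_diagonal :: (3 + 4 \<times> 4 + 3 \<times> 3) set) = 8"
    by (simp add: below_diagonal_def)
  finally show "card coframe_index = 17"
    by simp
qed

lemma axis_axis_nth: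
  "(axis i (axis j c) :: 'a::zero^'n^'m) $ a $ b = (if a = i \<and> b = j then c else 0)"
  by (cases "a = i") (simp_all add: axis_def)

lemma coframe_independent:
  assumes x: "x \<in> frame_bundle \<times> param_L0"
  shows "cfun.independent (coframe x ` coframe_index)" "card (coframe x ` coframe_index) = 17"
proof -
  have F: "fst x \<in> frame_bundle" and L0: "snd x \<in> param_L0"
    using x by auto
  define l where "l = snd x"
  have l12: "1 + l $ 1 * l $ 2 \<noteq> 0"
    using param_L0_facts(3)[OF L0] by (simp add: l_def)
  \<comment> \<open>The dual vectors: for the first two parameters the third component is dictated
    by the linearised equation; for \<phi> and \<kappa> elementary skew and elementary matrices
    serve.\<close>
  define v :: "3 + 4 \<times> 4 + 3 \<times> 3 \<Rightarrow> point" where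
    "v n = (case n of
        Inl m \<Rightarrow> frame_motion (fst x) 0 0 (if m = 1
          then vector [1, 0, - (1 + l $ 2 * l $ 3) / (1 + l $ 1 * l $ 2)]
          else vector [0, 1, - (1 + l $ 1 * l $ 3) / (1 + l $ 1 * l $ 2)])
      | Inr (Inl (i, j)) \<Rightarrow> frame_motion (fst x) (axis i (axis j 1) - axis j (axis i 1)) 0 0
      | Inr (Inr (a, b)) \<Rightarrow> frame_motion (fst x) 0 (axis a (axis b 1)) 0)" for n
  have "vector [1, 0, - (1 + l $ 2 * l $ 3) / (1 + l $ 1 * l $ 2)] \<in> param_tangent l"
    "vector [0, 1, - (1 + l $ 1 * l $ 3) / (1 + l $ 1 * l $ 2)] \<in> param_tangent l"
    "0 \<in> param_tangent l"
    using l12 by (simp_all add: param_tangent_def divide_simps) (simp_all add: algebra_simps)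
  then have t: "v n \<in> tangent x" for n
    unfolding v_def
    by (auto split: sum.split prod.split simp: axis_def l_def intro!: frame_motion_tangent[OF F])
  have eval: "coframe x m (frame_motion (fst x) A B dl) = of_real (case m of Inl m \<Rightarrow> dl $ m
       | Inr (Inl (i, j)) \<Rightarrow> A $ i $ j | Inr (Inr (a, b)) \<Rightarrow> B $ a $ b)"
    if "frame_motion (fst x) A B dl \<in> tangent x" for m A B dl
    using that by (cases m) (auto simp: coframe_def tangent_form_def phi_form_frame_motion[OF F]
        kappa_form_frame_motion[OF F] split: sum.split, simp add: frame_motion_def)
  have "coframe x m (v n) = (if m = n then 1 else 0)"
    if m: "m \<in> coframe_index" and n: "n \<in> coframe_index" for m n
  proof -
    consider "n = Inl 1" | "n = Inl 2" | i j where "n = Inr (Inl (i, j))" "(i, j) \<in> below_diagonal"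
      | a b where "n = Inr (Inr (a, b))"
      using n unfolding coframe_index_def by fastforce
    then show ?thesis
    proof cases
      case 1
      then show ?thesis
        using m t[of n] by (auto simp: v_def eval coframe_index_def)
    next
      case 2
      then show ?thesis
        using m t[of n] by (auto simp: v_def eval coframe_index_def)
    next
      case 3
      have v_eq: "v n = frame_motion (fst x) (axis i (axis j 1) - axis j (axis i 1)) 0 0"
        using 3 by (simp add: v_def)
      have e: "coframe x m (v n) = of_real (case m of Inl m \<Rightarrow> 0
          | Inr (Inl (a, b)) \<Rightarrow> (if a = i \<and> b = j then 1 else 0) - (if a = j \<and> b = i then 1 else 0)
          | Inr (Inr (a, b)) \<Rightarrow> 0)"
        unfolding v_eq eval[OF t[of n, unfolded v_eq]] vector_minus_component axis_axis_nth zero_index ..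
      consider k where "m = Inl k" | a b where "m = Inr (Inl (a, b))" "(a, b) \<in> below_diagonal"
        | a b where "m = Inr (Inr (a, b))"
        using m unfolding coframe_index_def by fastforce
      then show ?thesis
      proof cases
        case 2
        \<comment> \<open>The entry -1 of the elementary skew matrix lies above the diagonal, where
          no member of the coframe is indexed.\<close>
        then have "\<not> (a = j \<and> b = i)"
          using below_diagonal_asym 3(2) by blast
        then have no_swap: "(if a = j \<and> b = i then 1 else 0) = (0 :: real)"
          by (rule if_not_P)
        show ?thesis
          unfolding e unfolding 2 3(1) sum.case prod.case no_swap by simp
      qed (unfold e, simp_all add: 3(1))
    next
      case 4
      then show ?thesis
        using m t[of n] by (auto simp: v_def eval coframe_index_def axis_axis_nth split: if_splits)
    qed
  qed
  then show "cfun.independent (coframe x ` coframe_index)" "card (coframe x ` coframe_index) = 17"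
    using independent_biorthogonal[of coframe_index "coframe x" v] card_coframe_index
    by (simp_all add: card_image)
qed

lemma tangent_forms_in_span:
  assumes x: "x \<in> frame_bundle \<times> param_L0"
  defines "B \<equiv> coframe x ` coframe_index"
  shows "tangent_form x (\<lambda>v. snd v $ m) \<in> cfun.span B" (is "?l m \<in> _")
    and "tangent_form x (phi_form i j x) \<in> cfun.span B"
    and "tangent_form x (kappa_form a b x) \<in> cfun.span B"
    and "tangent_form x (pi_form a i j x) \<in> cfun.span B"
proof -
  have F: "fst x \<in> frame_bundle" and L0: "snd x \<in> param_L0"
    using x by auto
  have base: "coframe x n \<in> cfun.span B" if "n \<in> coframe_index" for n
    unfolding B_def using that by (blast intro: cfun.span_base)
  have l1: "?l 1 \<in> cfun.span B" and l2: "?l 2 \<in> cfun.span B"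
    using base[of "Inl 1"] base[of "Inl 2"] by (simp_all add: coframe_index_def coframe_def)
  have l3: "?l 3 \<in> cfun.span B"
  proof -
    define c1 c2 c3 :: complex where "c1 = of_real (1 + snd x $ 2 * snd x $ 3)"
      and "c2 = of_real (1 + snd x $ 1 * snd x $ 3)" and "c3 = of_real (1 + snd x $ 1 * snd x $ 2)"
    have "c3 \<noteq> 0"
      unfolding c3_def using param_L0_facts(3)[OF L0] by (metis less_irrefl of_real_eq_0_iff)
    have "?l 3 = (\<lambda>v. (- c1 / c3) * ?l 1 v) + (\<lambda>v. (- c2 / c3) * ?l 2 v)"
    proof
      fix v
      have "c1 * ?l 1 v + c2 * ?l 2 v + c3 * ?l 3 v = 0"
        using fun_cong[OF tangent_form_param[of x], of v] by (simp add: c1_def c2_def c3_def)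
      then show "?l 3 v = ((\<lambda>v. (- c1 / c3) * ?l 1 v) + (\<lambda>v. (- c2 / c3) * ?l 2 v)) v"
        using \<open>c3 \<noteq> 0\<close> by (simp add: field_simps eq_neg_iff_add_eq_0)
    qed
    then show ?thesis
      by (simp only: cfun.span_add cfun.span_scale l1 l2)
  qed
  have "\<forall>m. ?l m \<in> cfun.span B"
    unfolding forall_3 using l1 l2 l3 by blast
  then show l: "?l m \<in> cfun.span B" for m
    by blast
  show p: "tangent_form x (phi_form i j x) \<in> cfun.span B" for i j
  proof -
    have neg: "tangent_form x (phi_form i j x) = - tangent_form x (phi_form j i x)" for i j
      by (rule tangent_form_skew[OF F])
    have "tangent_form x (phi_form i i x) v = 0" for i v
      using fun_cong[OF neg[of i i], of v] by simp
    then have diag: "tangent_form x (phi_form i i x) = 0" for i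
      by (simp add: fun_eq_iff)
    have low: "tangent_form x (phi_form i j x) \<in> cfun.span B"
      if "(i, j) \<in> below_diagonal" for i j
      using base[of "Inr (Inl (i, j))"] that by (auto simp: coframe_index_def coframe_def)
    consider "i = j" | "(i, j) \<in> below_diagonal"
      | "(j, i) \<in> below_diagonal"
      using below_diagonal_cases by blast
    then show ?thesis
    proof cases
      case 1
      then show ?thesis by (simp only: diag cfun.span_zero)
    next
      case 2
      then show ?thesis by (rule low)
    next
      case 3
      then show ?thesis by (subst neg) (intro cfun.span_neg low)
    qed
  qed
  show k: "tangent_form x (kappa_form a b x) \<in> cfun.span B" for a b
    using base[of "Inr (Inr (a, b))"] by (simp add: coframe_index_def coframe_def)
  have "tangent_form x (pi_form a i j x) =
     (\<Sum>m\<in>UNIV. (\<lambda>v. of_real (d_austere_S m $ a $ i $ j) * ?l m v))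
     - (\<Sum>k\<in>UNIV. (\<lambda>v. of_real (austere_S (snd x) $ a $ k $ j) * tangent_form x (phi_form k i x) v))
     - (\<Sum>k\<in>UNIV. (\<lambda>v. of_real (austere_S (snd x) $ a $ i $ k) * tangent_form x (phi_form k j x) v))
     + (\<Sum>b\<in>UNIV. (\<lambda>v. of_real (austere_S (snd x) $ b $ i $ j) * tangent_form x (kappa_form a b x) v))"
    by (rule tangent_form_pi)
  then show "tangent_form x (pi_form a i j x) \<in> cfun.span B"
    by (simp only: cfun.span_add cfun.span_diff cfun.span_sum cfun.span_scale l p k)
qed

lemma polar_form_eq:
  "(\<lambda>v. if v \<in> tangent x then of_real (pi_form a i j x v) * z $ k - of_real (pi_form a i k x v) * z $ j else 0)
    = (\<lambda>v. z $ k * tangent_form x (pi_form a i j x) v) - (\<lambda>v. z $ j * tangent_form x (pi_form a i k x) v)"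
  by (auto simp: fun_eq_iff tangent_form_def)

text \<open>A functional killing the polar forms but not the coframe is the same as a nonzero
  rank-one element of the tableau along \<open>z\<close>, so the two results on such elements give
  the two directions.\<close>

lemma polar_rank_less_iff:
  assumes x: "x \<in> frame_bundle \<times> param_L0" and "z \<noteq> 0"
  shows "cfun.dim (polar_forms x z) < 17 \<longleftrightarrow>
    snd x $ 2 = 1 \<and> z \<in> char_plane 2 3 \<i> \<union> char_plane 2 3 (- \<i>) \<or>
    snd x $ 1 = 1 \<and> z \<in> char_plane 3 2 \<i> \<union> char_plane 3 2 (- \<i>)" (is "_ \<longleftrightarrow> ?R")
proof -
  have F: "fst x \<in> frame_bundle" and L0: "snd x \<in> param_L0"
    using x by auto
  define B where "B = coframe x ` coframe_index"
  have B: "finite B" "cfun.independent B" "card B = 17"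
    unfolding B_def using card_coframe_index coframe_independent[OF x] by simp_all
  note sp = tangent_forms_in_span[OF x, folded B_def]
  have "polar_forms x z \<subseteq> cfun.span B"
    unfolding polar_forms_def polar_form_eq by (auto intro!: cfun.span_diff cfun.span_scale sp)
  note iff = dim_less_card_iff_functional[OF this B(1,2), unfolded B(3)]
  have minors_iff: "(\<forall>f\<in>polar_forms x z. g f = 0) \<longleftrightarrow>
      (\<forall>a i j k. g (tangent_form x (pi_form a i j x)) * z $ k = g (tangent_form x (pi_form a i k x)) * z $ j)"
    if "Vector_Spaces.linear (\<lambda>c (f :: point \<Rightarrow> complex) v. c * f v) (*) g" for g
  proof -
    interpret g: Vector_Spaces.linear "\<lambda>c (f :: point \<Rightarrow> complex) v. c * f v" "(*)" g
      by (rule that)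
    have "(\<forall>f\<in>polar_forms x z. g f = 0) \<longleftrightarrow>
      (\<forall>a i j k. j < k \<longrightarrow> g ((\<lambda>v. z $ k * tangent_form x (pi_form a i j x) v)
        - (\<lambda>v. z $ j * tangent_form x (pi_form a i k x) v)) = 0)"
      unfolding polar_forms_def polar_form_eq by blast
    also have "\<dots> \<longleftrightarrow>
      (\<forall>a i j k. j < k \<longrightarrow> g (tangent_form x (pi_form a i j x)) * z $ k = g (tangent_form x (pi_form a i k x)) * z $ j)"
      by (simp add: g.diff g.scale mult.commute)
    \<comment> \<open>Exchanging \<open>j\<close> and \<open>k\<close> exchanges the two sides, and
      \<open>j = k\<close> is trivial.\<close>
    also have "\<dots> \<longleftrightarrow> (\<forall>a i j k. g (tangent_form x (pi_form a i j x)) * z $ k = g (tangent_form x (pi_form a i k x)) * z $ j)"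
      by (metis linorder_less_linear)
    finally show ?thesis .
  qed
  show ?thesis
  proof
    assume "cfun.dim (polar_forms x z) < 17"
    then obtain g b where g: "Vector_Spaces.linear (\<lambda>c (f :: point \<Rightarrow> complex) v. c * f v) (*) g"
      and kill: "\<forall>f\<in>polar_forms x z. g f = 0" and b: "b \<in> B" "g b \<noteq> 0"
      using iff by blast
    interpret g: Vector_Spaces.linear "\<lambda>c (f :: point \<Rightarrow> complex) v. c * f v" "(*)" g
      by (rule g)
    define \<Lambda> \<Phi> K where "\<Lambda> m = g (tangent_form x (\<lambda>v. snd v $ m))"
      and "\<Phi> i j = g (tangent_form x (phi_form i j x))"
      and "K a b = g (tangent_form x (kappa_form a b x))" for m i j a b
    have pi: "g (tangent_form x (pi_form a i j x)) = pi_poly (snd x) \<Lambda> \<Phi> K a i j" for a i j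
      unfolding linear_tangent_form_pi[OF g] \<Lambda>_def \<Phi>_def K_def ..
    have skew: "\<Phi> i j = - \<Phi> j i" for i j
      unfolding \<Phi>_def by (subst tangent_form_skew[OF F]) (rule g.neg)
    have "g ((\<lambda>v. of_real (1 + snd x $ 2 * snd x $ 3) * tangent_form x (\<lambda>v. snd v $ 1) v)
      + (\<lambda>v. of_real (1 + snd x $ 1 * snd x $ 3) * tangent_form x (\<lambda>v. snd v $ 2) v)
      + (\<lambda>v. of_real (1 + snd x $ 1 * snd x $ 2) * tangent_form x (\<lambda>v. snd v $ 3) v)) = 0"
      unfolding tangent_form_param by (rule g.zero)
    then have tang: "\<Lambda> 1 * (1 + of_real (snd x $ 2 * snd x $ 3)) + \<Lambda> 2 * (1 + of_real (snd x $ 1 * snd x $ 3))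
       + \<Lambda> 3 * (1 + of_real (snd x $ 1 * snd x $ 2)) = 0"
      unfolding g.add g.scale \<Lambda>_def by (simp add: mult.commute)
    have minors: "pi_poly (snd x) \<Lambda> \<Phi> K a i j * z $ k = pi_poly (snd x) \<Lambda> \<Phi> K a i k * z $ j" for a i j k
      using kill unfolding minors_iff[OF g] pi by blast
    have "(\<exists>m. \<Lambda> m \<noteq> 0) \<or> (\<exists>i j. \<Phi> i j \<noteq> 0) \<or> (\<exists>a b. K a b \<noteq> 0)"
      using b by (auto simp: B_def coframe_index_def coframe_def \<Lambda>_def \<Phi>_def K_def)
    then show ?R
      by (rule rank_one_in_tableau[of _ \<Phi> \<Lambda> K, OF L0 skew tang minors \<open>z \<noteq> 0\<close>])
  next
    assume ?R
    then obtain s where s: "s^2 = -1"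
      and z: "snd x $ 2 = 1 \<and> z \<in> char_plane 2 3 s \<or> snd x $ 1 = 1 \<and> z \<in> char_plane 3 2 s"
      by (metis UnE power2_i power2_minus)
    obtain \<Phi> \<Lambda> K where skew: "\<And>i j. \<Phi> i j = - \<Phi> j i"
      and tang: "\<Lambda> 1 * (1 + of_real (snd x $ 2 * snd x $ 3)) + \<Lambda> 2 * (1 + of_real (snd x $ 1 * snd x $ 3))
       + \<Lambda> 3 * (1 + of_real (snd x $ 1 * snd x $ 2)) = 0"
      and minors: "\<And>a i j k. pi_poly (snd x) \<Lambda> \<Phi> K a i j * z $ k = pi_poly (snd x) \<Lambda> \<Phi> K a i k * z $ j"
      and nz: "\<exists>i j. \<Phi> i j \<noteq> 0"
      by (rule rank_one_in_tableau_exists[OF L0 \<open>z \<noteq> 0\<close> s z]) blast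
    obtain g where g: "Vector_Spaces.linear (\<lambda>c (f :: point \<Rightarrow> complex) v. c * f v) (*) g"
      and g_eq: "\<And>m. g (tangent_form x (\<lambda>v. snd v $ m)) = \<Lambda> m"
      "\<And>i j. g (tangent_form x (phi_form i j x)) = \<Phi> i j"
      "\<And>a b. g (tangent_form x (kappa_form a b x)) = K a b"
      by (rule tangent_functional_exists[of x \<Phi> \<Lambda> K, OF F skew tang]) blast
    interpret p: vector_space_pair "\<lambda>c (f :: point \<Rightarrow> complex) v. c * f v" "(*) :: complex \<Rightarrow> _"
      by (intro vector_space_pair.intro cfun.vector_space_axioms vector_space_over_itself.vector_space_axioms)
    have "\<forall>f\<in>polar_forms x z. g f = 0"
      unfolding minors_iff[OF g] linear_tangent_form_pi[OF g] g_eq using minors by blast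
    moreover have "\<exists>b\<in>B. g b \<noteq> 0"
    proof (rule ccontr)
      assume "\<not> (\<exists>b\<in>B. g b \<noteq> 0)"
      then have "g f = 0" if "f \<in> cfun.span B" for f
        by (intro p.linear_eq_0_on_span[OF g _ that]) blast
      from this[OF sp(2)] nz g_eq(2) show False
        by metis
    qed
    ultimately show "cfun.dim (polar_forms x z) < 17"
      using iff g by blast
  qed
qed

subsection \<open>Covectors and projective lines\<close>

lemma covector_add: "covector x E (z + w) = covector x E z + covector x E w"
  by (auto simp: covector_def fun_eq_iff sum.distrib distrib_right)

lemma covector_scale: "covector x E (c *s z) = (\<lambda>v. c * covector x E z v)"
  by (auto simp: covector_def fun_eq_iff sum_distrib_left mult.assoc)

lemma omega_form_linear:
  assumes "fst x \<in> frame_bundle"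
  shows "omega_form i x (u + v) = omega_form i x u + omega_form i x v"
    and "omega_form i x (c *\<^sub>R v) = c * omega_form i x v"
  using linear_frame_coeffs[OF assms]
  by (simp_all add: omega_form_def d_p_def linear_add linear_cmul)

lemma covector_complex_dual:
  assumes "fst x \<in> frame_bundle" and E: "subspace E"
  shows "covector x E z \<in> complex_dual E"
  using subspace_add[OF E] subspace_scale[OF E]
  by (auto simp: complex_dual_def covector_def omega_form_linear[OF assms(1)] algebra_simps
      sum.distrib sum_distrib_left)

text \<open>The independence condition provides vectors of \<open>E\<close> on which the \<omega>
  forms have a nonsingular real matrix; real and imaginary parts of the coefficients are recovered
  separately.\<close>

lemma covector_inj:
  assumes "integral_plane x E"
  shows "inj (covector x E)"
proof -
  obtain b :: "4 \<Rightarrow> point" where b: "\<And>j. b j \<in> E" "det (\<chi> i j. omega_form i x (b j)) \<noteq> 0"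
    using assms by (auto simp: integral_plane_def)
  define M :: "real^4^4" where "M = (\<chi> i j. omega_form i x (b j))"
  have "invertible (transpose M)"
    using b(2) by (simp add: M_def invertible_det_nz)
  then have real0: "w = 0" if "\<And>j. (\<Sum>i\<in>UNIV. w $ i * omega_form i x (b j)) = 0" for w :: "real^4"
  proof -
    have "transpose M *v w = 0"
      using that by (simp add: M_def matrix_vector_mult_def transpose_def vec_eq_iff mult.commute)
    with \<open>invertible (transpose M)\<close> show ?thesis
      by (metis invertible_def matrix_left_invertible_ker)
  qed
  show ?thesis
  proof (rule injI)
    fix z w
    assume "covector x E z = covector x E w"
    then have "(\<Sum>i\<in>UNIV. (z - w) $ i * of_real (omega_form i x (b j))) = 0" for j
      using fun_cong[of _ _ "b j"] b(1)[of j]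
      by (fastforce simp: covector_def algebra_simps sum_subtractf)
    then have eq: "(\<Sum>i\<in>UNIV. Re ((z - w) $ i) * omega_form i x (b j)) = 0"
      "(\<Sum>i\<in>UNIV. Im ((z - w) $ i) * omega_form i x (b j)) = 0" for j
      by (simp_all add: complex_eq_iff del: vector_minus_component)
    have "(\<chi> i. Re ((z - w) $ i)) = 0" "(\<chi> i. Im ((z - w) $ i)) = 0"
      by (rule real0, simp only: vec_lambda_beta eq)+
    then show "z = w"
      by (simp add: vec_eq_iff complex_eq_iff)
  qed
qed

lemma covector_eq_0_iff:
  assumes "integral_plane x E"
  shows "covector x E z = 0 \<longleftrightarrow> z = 0"
proof -
  have "covector x E 0 = 0"
    by (simp add: covector_def fun_eq_iff)
  then show ?thesis
    using inj_eq[OF covector_inj[OF assms], of z 0] by simp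
qed

definition plane_line :: "point \<Rightarrow> point set \<Rightarrow> (complex^4) set \<Rightarrow> (point \<Rightarrow> complex) set set" where
  "plane_line x E W = projectivization (covector x E ` W)"

text \<open>A projective point determines \<open>z\<close> up to a scalar, which \<open>W\<close>
  absorbs. Equality of projective lines can thus be tested on the planes in coordinates.\<close>

lemma mem_plane_line:
  assumes E: "integral_plane x E" and scale: "\<And>c w. w \<in> W \<Longrightarrow> c *s w \<in> W" and "z \<noteq> 0"
  shows "proj_point (covector x E z) \<in> plane_line x E W \<longleftrightarrow> z \<in> W"
proof
  assume "z \<in> W"
  with \<open>z \<noteq> 0\<close> show "proj_point (covector x E z) \<in> plane_line x E W"
    by (auto simp: plane_line_def projectivization_def covector_eq_0_iff[OF E])
next
  assume "proj_point (covector x E z) \<in> plane_line x E W"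
  then obtain w where w: "w \<in> W" "proj_point (covector x E z) = proj_point (covector x E w)"
    unfolding plane_line_def projectivization_def by blast
  have "covector x E z \<in> proj_point (covector x E w)"
    unfolding w(2)[symmetric] unfolding proj_point_def by (rule cfun.span_base) simp
  then obtain c where "covector x E z = covector x E (c *s w)"
    by (auto simp: proj_point_def cfun.span_singleton covector_scale)
  then show "z \<in> W"
    using scale[OF w(1)] inj_eq[OF covector_inj[OF E]] by simp
qed

lemma char_plane_scale: "w \<in> char_plane i j s \<Longrightarrow> c *s w \<in> char_plane i j s"
  by (simp add: char_plane_def mult_ac)

lemma complex_line_char_plane:
  assumes F: "fst x \<in> frame_bundle" and E: "integral_plane x E" and ij: "(i, j) \<in> {(2, 3), (3, 2)}"
  shows "complex_line E (plane_line x E (char_plane i j s))"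
proof -
  have ij_cases: "thesis" if "i = 2 \<Longrightarrow> j = 3 \<Longrightarrow> thesis" "i = 3 \<Longrightarrow> j = 2 \<Longrightarrow> thesis" for thesis
    using ij that by auto
  \<comment> \<open>The basis of the plane belonging to the free coordinates \<open>z $ 1\<close>
    and \<open>z $ j\<close>.\<close>
  define w1 w2 :: "complex^4" where "w1 = axis 1 1 + axis i s" and "w2 = axis j 1 + axis 4 (- s)"
  have plane: "char_plane i j s = {a *s w1 + b *s w2 | a b. True}"
  proof (intro set_eqI iffI)
    fix z
    assume "z \<in> char_plane i j s"
    then have "z = z $ 1 *s w1 + z $ j *s w2"
      by - (rule ij_cases; simp add: char_plane_def w1_def w2_def vec_eq_iff forall_4 axis_def)
    then show "z \<in> {a *s w1 + b *s w2 | a b. True}"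
      by blast
  next
    fix z
    assume "z \<in> {a *s w1 + b *s w2 | a b. True}"
    then show "z \<in> char_plane i j s"
      by - (rule ij_cases; auto simp: char_plane_def w1_def w2_def axis_def)
  qed
  let ?c = "covector x E"
  have span: "?c ` char_plane i j s = cfun.span {?c w1, ?c w2}"
  proof -
    have "f \<in> cfun.span {?c w1, ?c w2} \<longleftrightarrow> (\<exists>a b. f = ?c (a *s w1 + b *s w2))" for f
      unfolding cfun.span_insert[of "?c w1" "{?c w2}"] cfun.span_singleton
      by (simp add: covector_add covector_scale image_iff diff_eq_eq add.commute)
    then show ?thesis
      unfolding plane by (auto intro!: imageI) blast
  qed
  have w: "w1 \<noteq> k *s w2" "w2 \<noteq> 0" for k
    by (rule ij_cases; simp add: w1_def w2_def vec_eq_iff forall_4 axis_def)+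
  have w1: "?c w1 \<notin> cfun.span {?c w2}"
    using w(1) by (auto simp: cfun.span_singleton inj_eq[OF covector_inj[OF E]] simp flip: covector_scale)
  then have "?c w1 \<noteq> ?c w2"
    by (auto intro: cfun.span_base)
  moreover have "?c w2 \<noteq> 0"
    using w(2) by (simp add: covector_eq_0_iff[OF E])
  then have "cfun.independent {?c w1, ?c w2}"
    using w1 by (intro cfun.independent_insertI cfun.independent_empty) auto
  ultimately have "cfun.dim (cfun.span {?c w1, ?c w2}) = 2"
    by (simp add: cfun.dim_eq_card_independent)
  moreover have "?c ` char_plane i j s \<subseteq> complex_dual E"
    using covector_complex_dual[OF F] E by (auto simp: integral_plane_def)
  ultimately show ?thesis
    unfolding complex_line_def plane_line_def span
    by (intro exI[of _ "cfun.span {?c w1, ?c w2}"]) simp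
qed

lemma plane_line_eq_iff:
  assumes "integral_plane x E"
  shows "plane_line x E (char_plane i j s) = plane_line x E (char_plane i' j' s') \<longleftrightarrow>
    char_plane i j s = char_plane i' j' s'"
proof
  assume eq: "plane_line x E (char_plane i j s) = plane_line x E (char_plane i' j' s')"
  have "z \<in> char_plane i j s \<longleftrightarrow> z \<in> char_plane i' j' s'" for z
  proof (cases "z = 0")
    case True
    then show ?thesis by (simp add: char_plane_def)
  next
    case False
    show ?thesis
      using mem_plane_line[OF assms char_plane_scale False] eq by metis
  qed
  then show "char_plane i j s = char_plane i' j' s'"
    by blast
qed simp

lemma char_plane_distinct:
  "distinct [char_plane 2 3 \<i>, char_plane 2 3 (- \<i>), char_plane 3 2 \<i>, char_plane 3 2 (- \<i>)]"
proof -
  \<comment> \<open>The vectors (1, s, 0, 0) and (1, 0, s, 0) separate the four planes.\<close>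
  have in_plane: "axis 1 1 + axis 2 s \<in> char_plane 2 3 s" "axis 1 1 + axis 3 s \<in> char_plane 3 2 s" for s
    by (simp_all add: char_plane_def axis_def)
  have not_in_plane: "axis 1 1 + axis 2 s \<notin> char_plane 2 3 t" "axis 1 1 + axis 3 s \<notin> char_plane 3 2 t"
    if "s \<noteq> t" for s t
    using that by (simp_all add: char_plane_def axis_def)
  have cross: "axis 1 1 + axis 2 s \<notin> char_plane 3 2 t" if "t \<noteq> 0" for s t
    using that by (simp add: char_plane_def axis_def)
  have ne: "\<i> \<noteq> - \<i>"
    by (simp add: complex_eq_iff)
  show ?thesis
    using in_plane not_in_plane[OF ne] cross[of \<i>] cross[of "- \<i>"] by (simp, metis complex_i_not_zero)
qed

lemma char_variety_eq:
  assumes x: "x \<in> frame_bundle \<times> param_L0" and E: "integral_plane x E"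
  shows "char_variety x E = plane_line x E {z.
    snd x $ 2 = 1 \<and> z \<in> char_plane 2 3 \<i> \<union> char_plane 2 3 (- \<i>) \<or>
    snd x $ 1 = 1 \<and> z \<in> char_plane 3 2 \<i> \<union> char_plane 3 2 (- \<i>)}"
proof -
  show ?thesis
    unfolding char_variety_def plane_line_def projectivization_def
    using polar_rank_less_iff[OF x] by (auto simp: covector_eq_0_iff[OF E])
qed

lemma plane_line_Un: "plane_line x E (V \<union> W) = plane_line x E V \<union> plane_line x E W"
  by (auto simp: plane_line_def projectivization_def)

text \<open>Each of the first two parameters that equals 1 contributes its own pair of lines; where
  both equal 1, the variety is the union of two pairs, with four distinct lines.\<close>

theorem proposition12:
  fixes x :: point and E :: "point set"
  assumes "x \<in> frame_bundle \<times> param_L0"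
    and "integral_plane x E"
    and "\<And>a i j v. v \<in> E \<Longrightarrow> pi_form a i j x v = 0"
  shows "(snd x $ 1 \<noteq> 1 \<and> snd x $ 2 \<noteq> 1 \<longrightarrow> char_variety x E = {}) \<and>
    ((snd x $ 1 = 1) \<noteq> (snd x $ 2 = 1) \<longrightarrow>
      (\<exists>M1 M2. complex_line E M1 \<and> complex_line E M2 \<and> M1 \<noteq> M2 \<and>
        char_variety x E = M1 \<union> M2)) \<and>
    (snd x $ 1 = 1 \<and> snd x $ 2 = 1 \<longrightarrow>
      (\<exists>M1 M2 M3 M4. (\<forall>M\<in>{M1, M2, M3, M4}. complex_line E M) \<and>
        distinct [M1, M2, M3, M4] \<and> char_variety x E = (M1 \<union> M2) \<union> (M3 \<union> M4)))"
proof -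
  \<comment> \<open>\<open>A1\<close> and \<open>A2\<close> belong to \<open>snd x $ 2 = 1\<close>,
    while \<open>B1\<close> and \<open>B2\<close> belong to \<open>snd x $ 1 = 1\<close>.\<close>
  define A1 A2 B1 B2 where "A1 = plane_line x E (char_plane 2 3 \<i>)"
    and "A2 = plane_line x E (char_plane 2 3 (- \<i>))"
    and "B1 = plane_line x E (char_plane 3 2 \<i>)"
    and "B2 = plane_line x E (char_plane 3 2 (- \<i>))"
  have F: "fst x \<in> frame_bundle"
    using assms(1) by auto
  have lines: "complex_line E A1" "complex_line E A2" "complex_line E B1" "complex_line E B2"
    unfolding A1_def A2_def B1_def B2_def by (rule complex_line_char_plane[OF F assms(2)]; simp)+
  have dist: "distinct [A1, A2, B1, B2]"
    using char_plane_distinct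
    unfolding A1_def A2_def B1_def B2_def by (simp add: plane_line_eq_iff[OF assms(2)])
  note eq = char_variety_eq[OF assms(1,2)]
  have none: "char_variety x E = {}" if "snd x $ 1 \<noteq> 1" "snd x $ 2 \<noteq> 1"
    unfolding eq using that by (simp add: plane_line_def projectivization_def)
  have second: "char_variety x E = A1 \<union> A2" if "snd x $ 1 \<noteq> 1" "snd x $ 2 = 1"
    unfolding eq A1_def A2_def plane_line_Un[symmetric]
    using that by (intro arg_cong[where f = "plane_line x E"]) auto
  have first: "char_variety x E = B1 \<union> B2" if "snd x $ 1 = 1" "snd x $ 2 \<noteq> 1"
    unfolding eq B1_def B2_def plane_line_Un[symmetric]
    using that by (intro arg_cong[where f = "plane_line x E"]) auto
  have both: "char_variety x E = (A1 \<union> A2) \<union> (B1 \<union> B2)" if "snd x $ 1 = 1" "snd x $ 2 = 1"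
    unfolding eq A1_def A2_def B1_def B2_def plane_line_Un[symmetric]
    using that by (intro arg_cong[where f = "plane_line x E"]) auto
  show ?thesis
  proof (intro conjI impI)
    show "char_variety x E = {}" if "snd x $ 1 \<noteq> 1 \<and> snd x $ 2 \<noteq> 1"
      using that none by blast
    show "\<exists>M1 M2. complex_line E M1 \<and> complex_line E M2 \<and> M1 \<noteq> M2 \<and> char_variety x E = M1 \<union> M2"
      if "(snd x $ 1 = 1) \<noteq> (snd x $ 2 = 1)"
    proof (cases "snd x $ 1 = 1")
      case True
      then show ?thesis
        using that first lines dist by (intro exI[of _ B1] exI[of _ B2]) simp
    next
      case False
      then show ?thesis
        using that second lines dist by (intro exI[of _ A1] exI[of _ A2]) simp
    qed
    show "\<exists>M1 M2 M3 M4. (\<forall>M\<in>{M1, M2, M3, M4}. complex_line E M) \<and>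
        distinct [M1, M2, M3, M4] \<and> char_variety x E = (M1 \<union> M2) \<union> (M3 \<union> M4)"
      if "snd x $ 1 = 1 \<and> snd x $ 2 = 1"
      using that both lines dist
      by (intro exI[of _ A1] exI[of _ A2] exI[of _ B1] exI[of _ B2] conjI) simp_all
  qed
qed

end
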